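(* (1) For every $\alpha>2$ and $k>1$ there are constants $c(\alpha,k),C(\alpha,k)>0$ depending only on $\alpha,k$ such that for all $n$, \[c(\alpha,k)\frac{\log n}{\log\log n}\le D_k(\alpha,n)\le C(\alpha,k)\frac{\log n}{\log\log n}.\] (2) For every $1<\alpha<2$ and $k>1$ there are constants $c(\alpha,k)>0$ depending only on $\alpha,k$ and $C(k)>0$ depending only on $k$ such that for all $n$, \[c(\alpha,k)\sqrt{\log n}\le D_k(\alpha,n)\le C(k)\sqrt{\log n}.\] (3) For every $\alpha>1$ there is $c(\alpha)>0$ depending only on $\alpha$, and there is an absolute constant $C>0$, such that for all $n$, \[c(\alpha)\log n\le D_1(\alpha,n)\le C\log n.\]
   Context: For metric spaces $M,X$ and an injective map $f:M\to X$, the distortion is $\mathrm{dist}(f)=\sup_{x\ne y}\frac{d_X(f(x),f(y))}{d_M(x,y)}\cdot\sup_{x\ne y}\frac{d_M(x,y)}{d_X(f(x),f(y))}$; $M$ $\alpha$-embeds in $X$ if some $f$ has $\mathrm{dist}(f)\le\alpha$. An equilateral space is a metric space in which all pairwise distances are equal. For $k\ge1$, a sequence $a_1\ge a_2\ge\dots\ge a_m>0$ is $k$-lacunary if $a_{i+1}\le a_i/k$ for all $i$; a metric $d$ on $\{1,\dots,m\}$ is a $k$-lacunary metric (space) if there is a $k$-lacunary sequence $a_1\ge\dots\ge a_m>0$ with $d(i,j)=a_i$ for all $1\le i<j\le m$. $D_k(\alpha,n)$ is the largest integer $m$ such that every $n$-point metric space has an $m$-point subspace that $\alpha$-embeds into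 some space which is either a $k$-lacunary space or an equilateral space.
   Formalization: "For all n" is read as n ≥ 3 in (1) and n ≥ 2 in (2) and (3), with natural logarithms: at n = 1 the upper bounds in (2) and (3) would read 1 ≤ 0, and in (1) log n / log log n is undefined at n = 1 and negative at n = 2. *)

theory Defs
  imports "HOL-Analysis.Analysis"
begin

(* The suprema are taken in ennreal, where the supremum of the empty set is 0: a map
   from a space with at most one point has distortion 0, and so counts as an embedding
   for every \<alpha>. *)
definition distortion ::
    "'a set \<Rightarrow> ('a \<Rightarrow> 'a \<Rightarrow> real) \<Rightarrow> ('b \<Rightarrow> 'b \<Rightarrow> real) \<Rightarrow> ('a \<Rightarrow> 'b) \<Rightarrow> ennreal" where
  "distortion M dM dX f =
     (SUP (x, y) \<in> {(x, y). x \<in> M \<and> y \<in> M \<and> x \<noteq> y}. ennreal (dX (f x) (f y) / dM x y)) *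
     (SUP (x, y) \<in> {(x, y). x \<in> M \<and> y \<in> M \<and> x \<noteq> y}. ennreal (dM x y / dX (f x) (f y)))"

definition embeds ::
    "real \<Rightarrow> 'a set \<Rightarrow> ('a \<Rightarrow> 'a \<Rightarrow> real) \<Rightarrow> 'b set \<Rightarrow> ('b \<Rightarrow> 'b \<Rightarrow> real) \<Rightarrow> bool" where
  "embeds \<alpha> M dM X dX \<longleftrightarrow>
     (\<exists>f. f \<in> M \<rightarrow> X \<and> inj_on f M \<and> distortion M dM dX f \<le> ennreal \<alpha>)"

definition equilateral_space :: "'a set \<Rightarrow> ('a \<Rightarrow> 'a \<Rightarrow> real) \<Rightarrow> bool" where
  "equilateral_space X d \<longleftrightarrow>
     Metric_space X d \<and> (\<exists>r. \<forall>x\<in>X. \<forall>y\<in>X. x \<noteq> y \<longrightarrow> d x y = r)"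

definition lacunary_seq :: "real \<Rightarrow> nat \<Rightarrow> (nat \<Rightarrow> real) \<Rightarrow> bool" where
  "lacunary_seq k m a \<longleftrightarrow>
     (\<forall>i\<in>{1..m}. a i > 0) \<and>
     (\<forall>i\<in>{1..<m}. a (i + 1) \<le> a i) \<and>
     (\<forall>i\<in>{1..<m}. a (i + 1) \<le> a i / k)"

definition lacunary_metric :: "real \<Rightarrow> nat \<Rightarrow> (nat \<Rightarrow> nat \<Rightarrow> real) \<Rightarrow> bool" where
  "lacunary_metric k m d \<longleftrightarrow>
     Metric_space {1..m} d \<and>
     (\<exists>a. lacunary_seq k m a \<and> (\<forall>i j. 1 \<le> i \<and> i < j \<and> j \<le> m \<longrightarrow> d i j = a i))"

(* Only finite spaces are ever embedded, so equilateral targets on sets of naturals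
   cover all equilateral targets (see embeds_equilateral_imp below). *)
definition embeds_lacunary_or_equilateral ::
    "real \<Rightarrow> real \<Rightarrow> 'a set \<Rightarrow> ('a \<Rightarrow> 'a \<Rightarrow> real) \<Rightarrow> bool" where
  "embeds_lacunary_or_equilateral k \<alpha> S d \<longleftrightarrow>
     (\<exists>m dX. lacunary_metric k m dX \<and> embeds \<alpha> S d {1..m} dX) \<or>
     (\<exists>(X :: nat set) dX. equilateral_space X dX \<and> embeds \<alpha> S d X dX)"

(* Every n-point metric space is isometric to one on a set of naturals; D_universal below
   records that the resulting value applies to n-point spaces of any type. *)
definition D :: "real \<Rightarrow> real \<Rightarrow> nat \<Rightarrow> nat" where
  "D k \<alpha> n = Max {m. \<forall>(M :: nat set) d. Metric_space M d \<and> finite M \<and> card M = n \<longrightarrow>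
     (\<exists>S \<subseteq> M. card S = m \<and> embeds_lacunary_or_equilateral k \<alpha> S d)}"

lemma distortion_comp:
  assumes "inj_on g S"
  shows "distortion (g ` S) dM dX f = distortion S (\<lambda>x y. dM (g x) (g y)) dX (f \<circ> g)"
proof -
  have "{(x, y). x \<in> g ` S \<and> y \<in> g ` S \<and> x \<noteq> y} =
        (\<lambda>(x, y). (g x, g y)) ` {(x, y). x \<in> S \<and> y \<in> S \<and> x \<noteq> y}"
    using assms by (fastforce simp: inj_on_def)
  then show ?thesis
    unfolding distortion_def by (simp add: image_image case_prod_unfold)
qed

lemma embeds_image:
  assumes "inj_on g S" and "embeds \<alpha> S (\<lambda>x y. d (g x) (g y)) X dX"
  shows "embeds \<alpha> (g ` S) d X dX"
proof -
  obtain f where f: "f \<in> S \<rightarrow> X" "inj_on f S"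
    "distortion S (\<lambda>x y. d (g x) (g y)) dX f \<le> ennreal \<alpha>"
    using assms(2) unfolding embeds_def by blast
  let ?h = "inv_into S g"
  have eq: "(f \<circ> ?h \<circ> g) x = f x" if "x \<in> S" for x
    using that assms(1) by simp
  have "distortion S (\<lambda>x y. d (g x) (g y)) dX (f \<circ> ?h \<circ> g) =
        distortion S (\<lambda>x y. d (g x) (g y)) dX f"
    unfolding distortion_def using eq
    by (intro arg_cong2[where f = "(*)"] SUP_cong) auto
  then have "distortion (g ` S) d dX (f \<circ> ?h) \<le> ennreal \<alpha>"
    using f(3) by (simp add: distortion_comp[OF assms(1)])
  moreover have "f \<circ> ?h \<in> g ` S \<rightarrow> X"
    using f(1) assms(1) by auto
  moreover have "inj_on (f \<circ> ?h) (g ` S)"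
    using f(2) assms(1) by (auto simp: inj_on_def)
  ultimately show ?thesis
    unfolding embeds_def by blast
qed

lemma Metric_space_pullback:
  assumes "Metric_space M d" and "inj_on g N" and "g ` N \<subseteq> M"
  shows "Metric_space N (\<lambda>x y. d (g x) (g y))"
proof -
  interpret Metric_space M d by fact
  show ?thesis
  proof
    show "0 \<le> d (g x) (g y)" for x y by simp
    show "d (g x) (g y) = d (g y) (g x)" for x y by (rule commute)
    show "d (g x) (g y) = 0 \<longleftrightarrow> x = y" if "x \<in> N" "y \<in> N" for x y
    proof -
      have "g x \<in> M" "g y \<in> M" using that assms(3) by auto
      then show ?thesis using that assms(2) by (auto simp: inj_on_def)
    qed
    show "d (g x) (g z) \<le> d (g x) (g y) + d (g y) (g z)" if "x \<in> N" "y \<in> N" "z \<in> N" for x y z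
    proof -
      have "g x \<in> M" "g y \<in> M" "g z \<in> M" using that assms(3) by auto
      then show ?thesis by (rule triangle)
    qed
  qed
qed

lemma embeds_equilateral_imp:
  fixes X :: "'b set"
  assumes "finite S" and "equilateral_space X dX" and "embeds \<alpha> S d X dX"
  shows "embeds_lacunary_or_equilateral k \<alpha> S d"
proof -
  obtain f where f: "f \<in> S \<rightarrow> X" "inj_on f S" "distortion S d dX f \<le> ennreal \<alpha>"
    using assms(3) unfolding embeds_def by blast
  obtain r where X: "Metric_space X dX" and r: "\<And>x y. x \<in> X \<Longrightarrow> y \<in> X \<Longrightarrow> x \<noteq> y \<Longrightarrow> dX x y = r"
    using assms(2) unfolding equilateral_space_def by auto
  have "finite (f ` S)" using assms(1) by simp
  then obtain h :: "'b \<Rightarrow> nat" where h: "inj_on h (f ` S)"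
    using finite_imp_inj_to_nat_seg[of "f ` S"] by auto
  let ?Y = "h ` f ` S" and ?g = "inv_into (f ` S) h"
  let ?dY = "\<lambda>i j. dX (?g i) (?g j)"
  have g: "inj_on ?g ?Y" "?g ` ?Y \<subseteq> X"
    using h f(1) by (auto simp: inj_on_def)
  have "?dY i j = r" if "i \<in> ?Y" "j \<in> ?Y" "i \<noteq> j" for i j
    using that g by (intro r) (auto dest: inj_onD[OF g(1)])
  then have "equilateral_space ?Y ?dY"
    unfolding equilateral_space_def
    by (intro conjI Metric_space_pullback[OF X g] exI[of _ r] ballI impI)
  moreover have "distortion S d ?dY (h \<circ> f) = distortion S d dX f"
    unfolding distortion_def using h
    by (intro arg_cong2[where f = "(*)"] SUP_cong) auto
  then have "embeds \<alpha> S d ?Y ?dY"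
    unfolding embeds_def using f h by (intro exI[of _ "h \<circ> f"]) (auto intro: comp_inj_on)
  ultimately show ?thesis
    unfolding embeds_lacunary_or_equilateral_def by blast
qed

lemma D_set:
  fixes k \<alpha> :: real and n :: nat
  defines "A \<equiv> {m. \<forall>(M :: nat set) d. Metric_space M d \<and> finite M \<and> card M = n \<longrightarrow>
     (\<exists>S \<subseteq> M. card S = m \<and> embeds_lacunary_or_equilateral k \<alpha> S d)}"
  shows "finite A" and "A \<noteq> {}"
proof -
  have M: "Metric_space {..<n} (\<lambda>x y. if x = y then 0 else 1)"
    by unfold_locales auto
  have "A \<subseteq> {..n}"
  proof
    fix m assume "m \<in> A"
    then have "\<exists>S \<subseteq> {..<n}. card S = m \<and>
        embeds_lacunary_or_equilateral k \<alpha> S (\<lambda>x y. if x = y then 0 else 1)"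
      unfolding A_def mem_Collect_eq
      by (elim allE[of _ "{..<n}"] allE[of _ "\<lambda>x y. if x = y then 0 else 1"] impE) (use M in simp_all)
    then obtain S where "S \<subseteq> {..<n}" "card S = m" by blast
    then show "m \<in> {..n}" using card_mono[of "{..<n}" S] by simp
  qed
  then show "finite A" by (rule finite_subset) simp
  have "embeds_lacunary_or_equilateral k \<alpha> {} d" for d :: "nat \<Rightarrow> nat \<Rightarrow> real"
    by (rule embeds_equilateral_imp[where X = "{} :: nat set" and dX = "\<lambda>x y. 0"])
      (auto simp: equilateral_space_def embeds_def distortion_def Metric_space_def bot_ennreal)
  then have "0 \<in> A" unfolding A_def by (auto intro!: exI[of _ "{}"])
  then show "A \<noteq> {}" by blast
qed

lemma D_universal:
  fixes M :: "'a set"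
  assumes "Metric_space M d" and "finite M" and "card M = n"
  shows "\<exists>S \<subseteq> M. card S = D k \<alpha> n \<and> embeds_lacunary_or_equilateral k \<alpha> S d"
proof -
  obtain g where g: "bij_betw g {..<n} M"
    using ex_bij_betw_nat_finite[OF assms(2)] assms(3) by (auto simp: atLeast0LessThan)
  then have inj: "inj_on g {..<n}" and im: "g ` {..<n} = M"
    by (auto simp: bij_betw_def)
  have "Metric_space {..<n} (\<lambda>x y. d (g x) (g y))"
    using Metric_space_pullback[OF assms(1) inj] im by simp
  moreover have "D k \<alpha> n \<in> {m. \<forall>(M :: nat set) d. Metric_space M d \<and> finite M \<and> card M = n \<longrightarrow>
     (\<exists>S \<subseteq> M. card S = m \<and> embeds_lacunary_or_equilateral k \<alpha> S d)}"
    unfolding D_def by (rule Max_in[OF D_set])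
  ultimately have "\<exists>S \<subseteq> {..<n}. card S = D k \<alpha> n \<and>
      embeds_lacunary_or_equilateral k \<alpha> S (\<lambda>x y. d (g x) (g y))"
    unfolding mem_Collect_eq by simp
  then obtain S where S: "S \<subseteq> {..<n}" "card S = D k \<alpha> n"
    "embeds_lacunary_or_equilateral k \<alpha> S (\<lambda>x y. d (g x) (g y))"
    by blast
  have injS: "inj_on g S" using inj S(1) by (rule inj_on_subset)
  have "embeds_lacunary_or_equilateral k \<alpha> (g ` S) d"
    using S(3) embeds_image[OF injS] unfolding embeds_lacunary_or_equilateral_def by blast
  moreover have "g ` S \<subseteq> M" using S(1) im by blast
  ultimately show ?thesis using S(2) card_image[OF injS] by metis
qed

end

theory Submission
  imports Defs
begin

text \<open>
  Lower bounds. Every point is far from one end of a diametral pair, so from some point half of the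
  others lie at distance between half the diameter and the diameter; a constant fraction of these
  lie at the same distance up to a factor \<open>\<alpha>\<close>. Iterating yields logarithmically many points whose
  successive distance scales are nonincreasing up to a bounded error, hence nonincreasing along a
  subsequence of proportional length. This is a 1-lacunary subspace; for \<open>k > 1\<close> one keeps either a
  repeated scale or one point per scale, which costs a square root. If \<open>\<alpha> > 2\<close> and there is no
  \<open>\<alpha>\<close>-equilateral set with more than \<open>m\<close> points, then a maximal separated set provides a ball with a
  fraction \<open>1 / m\<close> of the points and with diameter smaller by the factor \<open>2 / \<alpha>\<close>. Boundedly many such
  steps make the diameter negligible and produce one further point of a lacunary sequence, and
  \<open>m\<close> points are reached if \<open>m ^ (r * m) \<le> n\<close>.

  Upper bounds. On sequences of length \<open>h\<close> over \<open>q\<close> symbols take the distance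
  \<open>w (x\<^sub>l, y\<^sub>l) / B ^ l\<close> where \<open>l\<close> is the first position of difference, \<open>w\<close> has values in
  \<open>{1, 2}\<close> and \<open>B > 2 * \<alpha>\<close>. An equilateral subset lives on one level and a lacunary one has
  boundedly many points per level. Constant \<open>w\<close> with \<open>h = q\<close> serves for \<open>\<alpha> > 2\<close>, and with \<open>q = 2\<close>
  for \<open>k = 1\<close>. For \<open>\<alpha> < 2\<close> one takes \<open>q = 2 ^ h\<close> and for \<open>w\<close> a two-colouring of pairs whose
  homogeneous sets have size \<open>O(h)\<close>, as in the lower bound of Erdos for Ramsey numbers.
\<close>

section \<open>Equilateral and lacunary targets\<close>

text \<open>Rescaling the target does not change the distortion, so it suffices to treat maps that
  do not increase distances: the two suprema are then at most 1 and at most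
  \<open>\<alpha>\<close>.\<close>

lemma embedsI:
  assumes "f \<in> S \<rightarrow> X" "inj_on f S" "\<alpha> \<ge> 0"
    and "\<And>x y. x \<in> S \<Longrightarrow> y \<in> S \<Longrightarrow> x \<noteq> y \<Longrightarrow>
      0 < dX (f x) (f y) \<and> dX (f x) (f y) \<le> d x y \<and> d x y \<le> \<alpha> * dX (f x) (f y)"
  shows "embeds \<alpha> S d X dX"
proof -
  have "(SUP (x, y) \<in> {(x, y). x \<in> S \<and> y \<in> S \<and> x \<noteq> y}. ennreal (dX (f x) (f y) / d x y)) \<le> ennreal 1"
  proof (intro SUP_least, clarify)
    fix x y assume "x \<in> S" "y \<in> S" "x \<noteq> y"
    then show "ennreal (dX (f x) (f y) / d x y) \<le> ennreal 1"
      using assms(4)[of x y] by (intro ennreal_leI) (auto simp: divide_simps)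
  qed
  moreover
  have "(SUP (x, y) \<in> {(x, y). x \<in> S \<and> y \<in> S \<and> x \<noteq> y}. ennreal (d x y / dX (f x) (f y))) \<le> ennreal \<alpha>"
  proof (intro SUP_least, clarify)
    fix x y assume "x \<in> S" "y \<in> S" "x \<noteq> y"
    then show "ennreal (d x y / dX (f x) (f y)) \<le> ennreal \<alpha>"
      using assms(4)[of x y] by (intro ennreal_leI) (auto simp: divide_simps)
  qed
  ultimately have "distortion S d dX f \<le> ennreal 1 * ennreal \<alpha>"
    unfolding distortion_def by (intro mult_mono) auto
  then show ?thesis using assms(1,2) unfolding embeds_def by auto
qed

lemma embeds_subset:
  assumes "embeds \<alpha> S d X dX" "T \<subseteq> S"
  shows "embeds \<alpha> T d X dX"
proof -
  obtain f where f: "f \<in> S \<rightarrow> X" "inj_on f S" "distortion S d dX f \<le> ennreal \<alpha>"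
    using assms(1) unfolding embeds_def by blast
  have "distortion T d dX f \<le> distortion S d dX f"
    unfolding distortion_def using assms(2) by (intro mult_mono SUP_subset_mono) auto
  then have "distortion T d dX f \<le> ennreal \<alpha>" using f(3) by (rule order_trans)
  moreover have "f \<in> T \<rightarrow> X" "inj_on f T" using f assms(2) by (auto intro: inj_on_subset)
  ultimately show ?thesis unfolding embeds_def by blast
qed

lemma embeds_lacunary_or_equilateral_subset:
  "embeds_lacunary_or_equilateral k \<alpha> S d \<Longrightarrow> T \<subseteq> S \<Longrightarrow> embeds_lacunary_or_equilateral k \<alpha> T d"
  unfolding embeds_lacunary_or_equilateral_def using embeds_subset by blast

text \<open>Embeddability passes to subsets, so a larger subspace can be cut down to exactly
  \<open>m\<close> points, as \<open>D\<close> requires.\<close>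

lemma D_ge:
  assumes "\<And>(M :: nat set) d. Metric_space M d \<Longrightarrow> finite M \<Longrightarrow> card M = n \<Longrightarrow>
    \<exists>S\<subseteq>M. m \<le> card S \<and> embeds_lacunary_or_equilateral k \<alpha> S d"
  shows "m \<le> D k \<alpha> n"
  unfolding D_def
proof (rule Max_ge[OF D_set(1)], intro CollectI allI impI)
  fix M :: "nat set" and d
  assume "Metric_space M d \<and> finite M \<and> card M = n"
  then obtain S where S: "S \<subseteq> M" "m \<le> card S" "embeds_lacunary_or_equilateral k \<alpha> S d"
    using assms[of M d] by blast
  then obtain T where "T \<subseteq> S" "card T = m" using obtain_subset_with_card_n[OF S(2)] by blast
  then show "\<exists>S\<subseteq>M. card S = m \<and> embeds_lacunary_or_equilateral k \<alpha> S d"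
    using S embeds_lacunary_or_equilateral_subset by blast
qed

lemma embeds_equilateralI:
  assumes "finite S" "b > 0" "\<alpha> \<ge> 0"
    and "\<And>x y. x \<in> S \<Longrightarrow> y \<in> S \<Longrightarrow> x \<noteq> y \<Longrightarrow> b \<le> d x y \<and> d x y \<le> \<alpha> * b"
  shows "embeds_lacunary_or_equilateral k \<alpha> S d"
proof (rule embeds_equilateral_imp[OF assms(1)])
  let ?e = "\<lambda>x y. if x = y then 0 else b"
  have "Metric_space S ?e" by unfold_locales (use \<open>b > 0\<close> in auto)
  then show "equilateral_space S ?e" unfolding equilateral_space_def by auto
  show "embeds \<alpha> S d S ?e"
    by (rule embedsI[where f = id]) (use assms in auto)
qed

text \<open>Decay is required of all pairs and not only of neighbours, so it survives renumbering
  the finite index set \<open>I\<close> by rank; any selection of indices can be fed in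
  directly.\<close>

lemma embeds_lacunaryI:
  fixes x :: "nat \<Rightarrow> 'a"
  assumes "finite I" "inj_on x I" "k \<ge> 1" "\<alpha> \<ge> 0"
    and sym: "\<And>u v. d u v = d v u"
    and b_pos: "\<And>i. i \<in> I \<Longrightarrow> b i > 0"
    and decay: "\<And>i j. i \<in> I \<Longrightarrow> j \<in> I \<Longrightarrow> i < j \<Longrightarrow> b j \<le> b i / k"
    and dist: "\<And>i j. i \<in> I \<Longrightarrow> j \<in> I \<Longrightarrow> i < j \<Longrightarrow> b i \<le> d (x i) (x j) \<and> d (x i) (x j) \<le> \<alpha> * b i"
  shows "embeds_lacunary_or_equilateral k \<alpha> (x ` I) d"
proof -
  define rank where "rank i = card {j \<in> I. j \<le> i}" for i
  let ?m = "card I"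
  have rank_less: "rank i < rank j" if "i \<in> I" "j \<in> I" "i < j" for i j
    unfolding rank_def
  proof (rule psubset_card_mono)
    have "j \<in> {l \<in> I. l \<le> j} - {l \<in> I. l \<le> i}" using that by simp
    moreover have "{l \<in> I. l \<le> i} \<subseteq> {l \<in> I. l \<le> j}" using that by auto
    ultimately show "{l \<in> I. l \<le> i} \<subset> {l \<in> I. l \<le> j}" by blast
  qed (use assms(1) in simp)
  have rank_inj: "inj_on rank I"
  proof (rule linorder_inj_onI)
    show "rank i \<noteq> rank j" if "i < j" "i \<in> I" "j \<in> I" for i j
      using rank_less[of i j] that by simp
  qed auto
  have rank_range: "rank i \<in> {1..?m}" if "i \<in> I" for i
  proof -
    have "{j \<in> I. j \<le> i} \<noteq> {}" using that by auto
    then show ?thesis unfolding rank_def using assms(1)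
      by (auto intro!: card_mono simp: Suc_le_eq card_gt_0_iff)
  qed
  have rank_image: "rank ` I = {1..?m}"
    using rank_range by (intro card_subset_eq) (auto simp: card_image[OF rank_inj])
  define a where "a r = b (inv_into I rank r)" for r
  have a_rank: "a (rank i) = b i" if "i \<in> I" for i
    using that rank_inj by (simp add: a_def)
  have ex_rank: "\<exists>i\<in>I. r = rank i" if "r \<in> {1..?m}" for r
    using that rank_image by blast
  have a_pos: "a r > 0" if "r \<in> {1..?m}" for r
    using ex_rank[OF that] b_pos a_rank by auto
  have a_decay: "a s \<le> a r / k" if rs: "r \<in> {1..?m}" "s \<in> {1..?m}" "r < s" for r s
  proof -
    obtain i j where ij: "i \<in> I" "j \<in> I" "r = rank i" "s = rank j"
      using ex_rank[OF rs(1)] ex_rank[OF rs(2)] by blast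
    then have "i < j" using rs(3) rank_less[of j i] by (metis nat_neq_iff less_asym)
    then show ?thesis using decay ij a_rank by simp
  qed
  have a_mono: "a s \<le> a r" if rs: "r \<in> {1..?m}" "s \<in> {1..?m}" "r \<le> s" for r s
  proof (cases "r = s")
    case False
    then have "a s \<le> a r / k" using a_decay[OF rs(1,2)] rs(3) by simp
    also have "a r / k \<le> a r / 1" using a_pos[OF rs(1)] \<open>k \<ge> 1\<close> by (intro divide_left_mono) auto
    finally show ?thesis by simp
  qed simp
  \<comment> \<open>\<open>max 0\<close> keeps the function nonnegative outside
    \<open>{1..?m}\<close> as well, since \<open>Metric_space\<close> asks for this at all
    arguments.\<close>
  define dX where "dX i j = (if i = j then 0 else max 0 (a (min i j)))" for i j :: nat
  have dX: "dX i j = a (min i j)" if "i \<in> {1..?m}" "j \<in> {1..?m}" "i \<noteq> j" for i j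
    using that a_pos[of "min i j"] by (auto simp: dX_def min_def)
  have "Metric_space {1..?m} dX"
  proof
    show "0 \<le> dX i j" "dX i j = dX j i" for i j by (auto simp: dX_def min.commute)
    show "dX i j = 0 \<longleftrightarrow> i = j" if "i \<in> {1..?m}" "j \<in> {1..?m}" for i j
    proof -
      have "a (min i j) > 0" using that by (intro a_pos) (auto simp: min_def)
      then show ?thesis by (auto simp: dX_def)
    qed
    show "dX i l \<le> dX i j + dX j l" if "i \<in> {1..?m}" "j \<in> {1..?m}" "l \<in> {1..?m}" for i j l
    proof (cases "i = l \<or> i = j \<or> j = l")
      case False
      have pos: "0 < a i" "0 < a j" "0 < a l" using a_pos that by auto
      \<comment> \<open>One of \<open>min i j\<close> and \<open>min j l\<close> is at most
        \<open>min i l\<close>, and \<open>a\<close> is nonincreasing: the target is an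
        ultrametric.\<close>
      have "a (min i l) \<le> a (min i j) \<or> a (min i l) \<le> a (min j l)"
        using that by (cases "i \<le> l") (auto simp: min_def intro: a_mono)
      moreover have "0 < a (min i j)" "0 < a (min j l)" using pos by (auto simp: min_def)
      ultimately show ?thesis using False that by (simp add: dX) linarith
    qed (auto simp: dX_def)
  qed
  moreover have "lacunary_seq k ?m a"
    unfolding lacunary_seq_def using a_pos a_decay a_mono by auto
  moreover have "\<forall>i j. 1 \<le> i \<and> i < j \<and> j \<le> ?m \<longrightarrow> dX i j = a i"
    by (auto simp: dX)
  ultimately have lac: "lacunary_metric k ?m dX" unfolding lacunary_metric_def by blast
  let ?f = "rank \<circ> inv_into I x"
  have f: "?f (x i) = rank i" if "i \<in> I" for i using that assms(2) by simp
  have bound: "0 < dX (rank i) (rank j) \<and> dX (rank i) (rank j) \<le> d (x i) (x j) \<and>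
      d (x i) (x j) \<le> \<alpha> * dX (rank i) (rank j)" if "i \<in> I" "j \<in> I" "i < j" for i j
  proof -
    have "dX (rank i) (rank j) = b i"
      using dX[of "rank i" "rank j"] rank_range rank_less[of i j] that a_rank[of i] by (simp add: min_def)
    then show ?thesis using dist[of i j] b_pos that by simp
  qed
  have dX_sym: "dX i j = dX j i" for i j by (auto simp: dX_def min.commute)
  have "embeds \<alpha> (x ` I) d {1..?m} dX"
  proof (rule embedsI)
    show "?f \<in> x ` I \<rightarrow> {1..?m}" using f rank_range by auto
    show "inj_on ?f (x ` I)" using f rank_inj by (auto simp: inj_on_def)
    fix u v assume "u \<in> x ` I" "v \<in> x ` I" "u \<noteq> v"
    then obtain i j where ij: "i \<in> I" "j \<in> I" "u = x i" "v = x j" "i \<noteq> j" by blast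
    consider "i < j" | "j < i" using ij by linarith
    then show "0 < dX (?f u) (?f v) \<and> dX (?f u) (?f v) \<le> d u v \<and> d u v \<le> \<alpha> * dX (?f u) (?f v)"
    proof cases
      case 1
      then show ?thesis using bound[of i j] ij f by simp
    next
      case 2
      then show ?thesis using bound[of j i] ij f sym[of u v] dX_sym by simp
    qed
  qed fact
  then show ?thesis unfolding embeds_lacunary_or_equilateral_def using lac by blast
qed

section \<open>Pigeonhole counting\<close>

lemma pigeonhole_fibre:
  assumes "finite A" "A \<noteq> {}" "f ` A \<subseteq> B" "finite B"
  obtains y where "y \<in> B" "card A \<le> card B * card {x \<in> A. f x = y}"
proof -
  have "\<exists>y\<in>B. card A \<le> card B * card {x \<in> A. f x = y}"
  proof (rule ccontr)
    assume neg: "\<not> ?thesis"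
    have "B \<noteq> {}" using assms by blast
    have "card A = (\<Sum>y\<in>B. card {x \<in> A. f x = y})"
      using sum.group[OF assms(1,4,3), of "\<lambda>_. 1 :: nat"] by simp
    then have "card B * card A = (\<Sum>y\<in>B. card B * card {x \<in> A. f x = y})"
      by (simp add: sum_distrib_left)
    also have "\<dots> < (\<Sum>y\<in>B. card A)"
      using neg \<open>B \<noteq> {}\<close> assms(4) by (intro sum_strict_mono) auto
    finally show False by simp
  qed
  then show ?thesis using that by blast
qed

lemma le_of_mult_le_mult_trans:
  fixes c :: nat
  assumes "c * q \<le> N" "N \<le> c * n" "c > 0"
  shows "q \<le> n"
  using assms by (metis le_trans mult_le_cancel1)

section \<open>Selecting points with aligned distance scales\<close>

definition scale :: "real \<Rightarrow> real \<Rightarrow> int" where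
  "scale \<beta> t = \<lfloor>log \<beta> t\<rfloor>"

lemma scale_le_iff: "\<beta> > 1 \<Longrightarrow> t > 0 \<Longrightarrow> p \<le> scale \<beta> t \<longleftrightarrow> \<beta> powi p \<le> t"
  by (simp add: scale_def le_floor_iff le_log_iff powr_real_of_int')

lemma scale_bounds:
  assumes "\<beta> > 1" "t > 0"
  shows "\<beta> powi (scale \<beta> t) \<le> t" "t < \<beta> * \<beta> powi (scale \<beta> t)"
proof -
  show "\<beta> powi (scale \<beta> t) \<le> t" using assms scale_le_iff by blast
  have "\<not> \<beta> powi (scale \<beta> t + 1) \<le> t" using scale_le_iff[OF assms, of "scale \<beta> t + 1"] by simp
  then show "t < \<beta> * \<beta> powi (scale \<beta> t)" using assms by (simp add: power_int_add mult.commute)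
qed

lemma scale_mono: "\<beta> > 1 \<Longrightarrow> 0 < s \<Longrightarrow> s \<le> t \<Longrightarrow> scale \<beta> s \<le> scale \<beta> t"
  unfolding scale_def by (intro floor_mono) simp

text \<open>\<open>2 \<le> \<beta> ^ K\<close> bounds \<open>log \<beta> 2\<close> by
  \<open>K\<close>. This shift by \<open>K\<close> is the error that the selected scales carry
  later.\<close>

lemma scale_half:
  assumes "\<beta> > 1" "t > 0" "2 \<le> \<beta> ^ K"
  shows "scale \<beta> t - int K \<le> scale \<beta> (t / 2)"
proof -
  have "log \<beta> 2 \<le> real K"
    using assms by (simp add: log_le_iff powr_realpow)
  then show ?thesis
    using assms unfolding scale_def by (simp add: log_divide) linarith
qed

context Metric_space
begin

lemma diameter_pair:
  assumes "N \<subseteq> M" "finite N" "2 \<le> card N"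
  obtains u v where "u \<in> N" "v \<in> N" "u \<noteq> v" "d u v > 0"
    "\<And>x y. x \<in> N \<Longrightarrow> y \<in> N \<Longrightarrow> d x y \<le> d u v"
proof -
  let ?P = "(\<lambda>(x, y). d x y) ` (N \<times> N)"
  have "N \<noteq> {}" using assms(3) by auto
  then have "Max ?P \<in> ?P" using assms(2) by (intro Max_in) auto
  then obtain u v where uv: "u \<in> N" "v \<in> N" "Max ?P = d u v" by auto
  have le: "d x y \<le> d u v" if "x \<in> N" "y \<in> N" for x y
    using Max_ge[of ?P "d x y"] assms(2) that uv(3) by auto
  obtain x y where xy: "x \<in> N" "y \<in> N" "x \<noteq> y"
    using assms by (metis card_le_Suc0_iff_eq not_numeral_le_zero not_less_eq_eq numeral_2_eq_2)
  then have "d x y > 0" using assms(1) mdist_pos_less by blast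
  then have "d u v > 0" using le[OF xy(1,2)] by simp
  moreover have "u \<noteq> v" using calculation uv(1) assms(1) mdist_zero by force
  ultimately show ?thesis using that uv le by blast
qed

text \<open>A point at distance at least half the diameter from half of the other points exists because
  every point is that far from one end of a diametral pair.\<close>

lemma split_scale:
  assumes "N \<subseteq> M" "finite N" "2 \<le> card N" "\<beta> > 1" "2 \<le> \<beta> ^ K"
  obtains x N' where "x \<in> N" "N' \<subseteq> N" "x \<notin> N'" "card N \<le> (2 * (K + 1)) * card N'"
    "\<And>y z. y \<in> N' \<Longrightarrow> z \<in> N' \<Longrightarrow> scale \<beta> (d x y) = scale \<beta> (d x z)"
    "\<And>y u v. y \<in> N' \<Longrightarrow> u \<in> N \<Longrightarrow> v \<in> N \<Longrightarrow> u \<noteq> v \<Longrightarrow> scale \<beta> (d u v) \<le> scale \<beta> (d x y) + int K"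
proof -
  obtain u v where uv: "u \<in> N" "v \<in> N" "u \<noteq> v" "d u v > 0"
    and le: "\<And>x y. x \<in> N \<Longrightarrow> y \<in> N \<Longrightarrow> d x y \<le> d u v"
    using diameter_pair[OF assms(1-3)] by metis
  let ?A = "\<lambda>x. {z \<in> N. d u v / 2 \<le> d x z}"
  have "N \<subseteq> ?A u \<union> ?A v"
  proof
    fix z assume "z \<in> N"
    then have "d u v \<le> d u z + d v z" using uv assms(1) by (intro triangle') auto
    then show "z \<in> ?A u \<union> ?A v" using \<open>z \<in> N\<close> by auto
  qed
  then have "card N \<le> card (?A u \<union> ?A v)" using assms(2) by (intro card_mono) auto
  also have "\<dots> \<le> card (?A u) + card (?A v)" by (rule card_Un_le)
  finally have "card N \<le> 2 * card (?A u) \<or> card N \<le> 2 * card (?A v)" by linarith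
  then obtain x where x: "x \<in> N" "card N \<le> 2 * card (?A x)" using uv by blast
  let ?P = "scale \<beta> (d u v)"
  \<comment> \<open>The distances lie between half the diameter and the diameter, which leaves
    \<open>K + 1\<close> scales. The choice of an end of the diametral pair contributes the factor 2
    in \<open>2 * (K + 1)\<close>.\<close>
  have range: "(\<lambda>z. scale \<beta> (d x z)) ` ?A x \<subseteq> {?P - int K..?P}"
  proof (intro image_subsetI)
    fix z assume z: "z \<in> ?A x"
    then have "0 < d x z" using uv(4) by auto
    have "scale \<beta> (d u v / 2) \<le> scale \<beta> (d x z)"
      using z uv(4) assms(4) by (intro scale_mono) auto
    moreover have "scale \<beta> (d x z) \<le> ?P"
      using le[OF x(1), of z] z \<open>0 < d x z\<close> assms(4) by (intro scale_mono) auto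
    ultimately show "scale \<beta> (d x z) \<in> {?P - int K..?P}"
      using scale_half[OF assms(4) uv(4) assms(5)] by simp
  qed
  have "card (?A x) \<noteq> 0" using x(2) assms(3) by linarith
  then have fin: "finite (?A x)" "?A x \<noteq> {}" using assms(2) by (simp, metis card.empty)
  obtain p where p: "p \<in> {?P - int K..?P}"
    "card (?A x) \<le> card {?P - int K..?P} * card {z \<in> ?A x. scale \<beta> (d x z) = p}"
    using pigeonhole_fibre[OF fin range] by auto
  let ?N = "{z \<in> ?A x. scale \<beta> (d x z) = p}"
  show ?thesis
  proof (rule that[of x ?N])
    have "d x x = 0" using x(1) assms(1) mdist_zero by blast
    then show "x \<notin> ?N" using uv(4) by simp
    have "card {?P - int K..?P} = K + 1" by simp
    then have "card (?A x) \<le> (K + 1) * card ?N" using p(2) by metis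
    then show "card N \<le> (2 * (K + 1)) * card ?N" using x(2) by linarith
    show "scale \<beta> (d r s) \<le> scale \<beta> (d x y) + int K" if "y \<in> ?N" "r \<in> N" "s \<in> N" "r \<noteq> s" for y r s
    proof -
      have "0 < d r s" using that assms(1) mdist_pos_less by blast
      then have "scale \<beta> (d r s) \<le> ?P"
        using le that assms(4) by (intro scale_mono) auto
      then show ?thesis using p(1) that(1) by simp
    qed
  qed (use x in auto)
qed

text \<open>\<open>split_scale\<close> is applied \<open>m\<close> times, each time inside the set
  it returned. All distances from \<open>x i\<close> to later points then have one scale, read off
  at the last point \<open>x m\<close>; later scales exceed it by at most \<open>K\<close> because
  they come from pairs in the set that was split.\<close>

lemma scale_sequence:
  assumes "N \<subseteq> M" "finite N" "(2 * (K + 1)) ^ m \<le> card N" "\<beta> > 1" "2 \<le> \<beta> ^ K"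
  shows "\<exists>x. inj_on x {..m} \<and> x ` {..m} \<subseteq> N \<and>
    (\<forall>i j. i < j \<and> j \<le> m \<longrightarrow> scale \<beta> (d (x i) (x j)) = scale \<beta> (d (x i) (x m))) \<and>
    (\<forall>i j. i < j \<and> j < m \<longrightarrow> scale \<beta> (d (x j) (x m)) \<le> scale \<beta> (d (x i) (x m)) + int K)"
  using assms(1-3)
proof (induction m arbitrary: N)
  case 0
  then have "N \<noteq> {}" by auto
  then obtain z where "z \<in> N" by blast
  then show ?case by (intro exI[of _ "\<lambda>_. z"]) auto
next
  case (Suc m)
  let ?c = "2 * (K + 1)"
  have "?c * ?c ^ m \<le> card N" using Suc.prems(3) by simp
  moreover have "?c ^ m \<ge> 1" by simp
  then have "2 * 1 \<le> ?c * ?c ^ m" by (intro mult_le_mono) auto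
  ultimately have "2 \<le> card N" by linarith
  then obtain z N' where z: "z \<in> N" "N' \<subseteq> N" "z \<notin> N'" and card: "card N \<le> ?c * card N'"
    and eq: "\<And>y y'. y \<in> N' \<Longrightarrow> y' \<in> N' \<Longrightarrow> scale \<beta> (d z y) = scale \<beta> (d z y')"
    and le: "\<And>y u v. y \<in> N' \<Longrightarrow> u \<in> N \<Longrightarrow> v \<in> N \<Longrightarrow> u \<noteq> v \<Longrightarrow>
      scale \<beta> (d u v) \<le> scale \<beta> (d z y) + int K"
    using split_scale[OF Suc.prems(1,2) _ assms(4,5)] by metis
  have "?c ^ m \<le> card N'"
    by (rule le_of_mult_le_mult_trans[OF _ card]) (use Suc.prems(3) in auto)
  moreover have "N' \<subseteq> M" "finite N'" using z Suc.prems finite_subset by blast+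
  ultimately obtain x where x: "inj_on x {..m}" "x ` {..m} \<subseteq> N'"
    "\<And>i j. i < j \<Longrightarrow> j \<le> m \<Longrightarrow> scale \<beta> (d (x i) (x j)) = scale \<beta> (d (x i) (x m))"
    "\<And>i j. i < j \<Longrightarrow> j < m \<Longrightarrow> scale \<beta> (d (x j) (x m)) \<le> scale \<beta> (d (x i) (x m)) + int K"
    using Suc.IH by metis
  let ?x = "case_nat z x"
  have x_mem: "x i \<in> N'" if "i \<le> m" for i using x(2) that by auto
  have "inj_on ?x {..Suc m}"
    using x(1) x_mem z(3) by (auto simp: inj_on_def split: nat.splits)
  moreover have "?x ` {..Suc m} \<subseteq> N"
    using x_mem z(1,2) by (auto split: nat.splits) blast
  moreover have "scale \<beta> (d (?x i) (?x j)) = scale \<beta> (d (?x i) (?x (Suc m)))"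
    if "i < j" "j \<le> Suc m" for i j
  proof -
    obtain j' where j': "j = Suc j'" "j' \<le> m" using \<open>i < j\<close> \<open>j \<le> Suc m\<close> by (cases j) auto
    show ?thesis
    proof (cases i)
      case 0
      then show ?thesis using eq[OF x_mem x_mem, of j' m] j' by simp
    next
      case (Suc i')
      then show ?thesis using x(3)[of i' j'] j' that by simp
    qed
  qed
  moreover have "scale \<beta> (d (?x j) (?x (Suc m))) \<le> scale \<beta> (d (?x i) (?x (Suc m))) + int K"
    if "i < j" "j < Suc m" for i j
  proof (cases i)
    case 0
    obtain j' where j': "j = Suc j'" "j' < m" using \<open>i < j\<close> \<open>j < Suc m\<close> by (cases j) auto
    have "x j' \<noteq> x m" using x(1) j' by (auto simp: inj_on_def)
    moreover have "x j' \<in> N" "x m \<in> N" "x m \<in> N'" using x_mem j' z(2) by (auto dest: subsetD)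
    ultimately show ?thesis using 0 j' le[of "x m" "x j'" "x m"] by simp
  next
    case (Suc i')
    then show ?thesis using that x(4)[of i' "j - 1"] by (cases j) auto
  qed
  ultimately show ?case by (intro exI[of _ ?x]) blast
qed

end

text \<open>The maxima \<open>P i\<close> over the tails are monotone, so \<open>p\<close> is monotone on any set of indices on which
  \<open>P i - p i\<close> is constant.\<close>

lemma monotone_selection:
  fixes p :: "nat \<Rightarrow> int"
  assumes "(K + 1) * r * s \<le> m" "0 < r" "0 < s"
    and almost: "\<forall>i j. i < j \<and> j < m \<longrightarrow> p j \<le> p i + int K"
  shows "\<exists>I\<subseteq>{..<m}. s \<le> card I \<and>
    (\<forall>i\<in>I. \<forall>j\<in>I. i < j \<longrightarrow> p j \<le> p i \<and> p i mod int r = p j mod int r)"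
proof -
  define P where "P i = Max (p ` {i..<m})" for i
  have P_ge: "p j \<le> P i" if "i \<le> j" "j < m" for i j
    unfolding P_def using that by (intro Max_ge) auto
  have P_le: "P i \<le> p i + int K" if "i < m" for i
  proof -
    have "p j \<le> p i + int K" if "i \<le> j" "j < m" for j
      using almost that by (cases "i = j") auto
    then show ?thesis unfolding P_def using that by (subst Max_le_iff) auto
  qed
  have P_mono: "P j \<le> P i" if "i \<le> j" "j < m" for i j
    unfolding P_def using that by (intro Max_mono) auto
  \<comment> \<open>The offset lies between 0 and \<open>K\<close> and the residue takes
    \<open>r\<close> values, hence \<open>(K + 1) * r\<close> classes. A common residue forces
    distinct selected levels to differ by at least \<open>r\<close>.\<close>
  let ?f = "\<lambda>i. (P i - p i, p i mod int r)"
  let ?B = "{0..int K} \<times> {0..<int r}"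
  have ran: "?f ` {..<m} \<subseteq> ?B"
    using P_ge[of i i for i] P_le \<open>0 < r\<close> by force
  have "0 < (K + 1) * r * s" using assms by simp
  then have "0 < m" using assms(1) by linarith
  then have ne: "{..<m} \<noteq> {}" by auto
  obtain y where y: "card {..<m} \<le> card ?B * card {i \<in> {..<m}. ?f i = y}"
    by (rule pigeonhole_fibre[OF finite_lessThan ne ran]) auto
  let ?I = "{i \<in> {..<m}. ?f i = y}"
  have B: "card ?B = (K + 1) * r" by (simp add: card_cartesian_product nat_add_distrib)
  show ?thesis
  proof (intro exI[of _ ?I] conjI ballI impI)
    show "s \<le> card ?I"
    proof (rule le_of_mult_le_mult_trans)
      show "((K + 1) * r) * s \<le> card {..<m}" using assms(1) by simp
      show "card {..<m} \<le> (K + 1) * r * card ?I" using y B by simp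
    qed (use \<open>0 < r\<close> in simp)
    fix i j assume ij: "i \<in> ?I" "j \<in> ?I" "i < j"
    then show "p j \<le> p i" "p i mod int r = p j mod int r"
      using P_mono[of i j] by (auto simp: prod_eq_iff)
  qed auto
qed

text \<open>From here on only the levels \<open>p i\<close> matter. The parameter \<open>r\<close>
  buys spacing: distinct levels are at least \<open>r\<close> apart, which later gives
  lacunarity.\<close>

lemma (in Metric_space) aligned_selection:
  assumes "N \<subseteq> M" "finite N" "(2 * (K + 1)) ^ ((K + 1) * r * s) \<le> card N"
    and "\<beta> > 1" "2 \<le> \<beta> ^ K" "0 < r" "0 < s"
  shows "\<exists>(x :: nat \<Rightarrow> 'a) (I :: nat set) (p :: nat \<Rightarrow> int).
    finite I \<and> inj_on x I \<and> x ` I \<subseteq> N \<and> s \<le> card I \<and>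
    (\<forall>i\<in>I. \<forall>j\<in>I. i < j \<longrightarrow> \<beta> powi p i \<le> d (x i) (x j) \<and> d (x i) (x j) \<le> \<beta> * \<beta> powi p i) \<and>
    (\<forall>i\<in>I. \<forall>j\<in>I. i < j \<longrightarrow> p j \<le> p i \<and> p i mod int r = p j mod int r)"
proof -
  let ?m = "(K + 1) * r * s"
  obtain x where x: "inj_on x {..?m}" "x ` {..?m} \<subseteq> N"
    "\<And>i j. i < j \<Longrightarrow> j \<le> ?m \<Longrightarrow> scale \<beta> (d (x i) (x j)) = scale \<beta> (d (x i) (x ?m))"
    "\<forall>i j. i < j \<and> j < ?m \<longrightarrow> scale \<beta> (d (x j) (x ?m)) \<le> scale \<beta> (d (x i) (x ?m)) + int K"
    using scale_sequence[OF assms(1-5)] by metis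
  define p where "p i = scale \<beta> (d (x i) (x ?m))" for i
  have almost: "\<forall>i j. i < j \<and> j < ?m \<longrightarrow> p j \<le> p i + int K"
    unfolding p_def by (rule x(4))
  obtain I where I: "I \<subseteq> {..<?m}" "s \<le> card I"
    "\<forall>i\<in>I. \<forall>j\<in>I. i < j \<longrightarrow> p j \<le> p i \<and> p i mod int r = p j mod int r"
    using monotone_selection[OF order_refl assms(6,7) almost] by blast
  have sub: "I \<subseteq> {..?m}" using I(1) by auto
  have x_mem: "x i \<in> M" if "i \<le> ?m" for i using x(2) that assms(1) by auto
  show ?thesis
  proof (intro exI[of _ x] exI[of _ I] exI[of _ p] conjI[OF _ conjI] conjI ballI impI)
    show "finite I" using I(1) finite_subset by blast
    show "inj_on x I" using x(1) sub by (rule inj_on_subset)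
    show "x ` I \<subseteq> N" using x(2) sub by blast
    show "s \<le> card I" by fact
    fix i j assume ij: "i \<in> I" "j \<in> I" "i < j"
    have "\<beta> powi p i \<le> d (x i) (x j) \<and> d (x i) (x j) \<le> \<beta> * \<beta> powi p i"
    proof -
      have le: "i \<le> ?m" "j \<le> ?m" using ij sub by auto
      have "x i \<noteq> x j" using x(1) le ij by (auto simp: inj_on_def)
      then have pos: "0 < d (x i) (x j)" using x_mem le mdist_pos_less by blast
      have "p i = scale \<beta> (d (x i) (x j))" unfolding p_def using x(3)[OF ij(3) le(2)] by simp
      then show ?thesis using scale_bounds[OF assms(4) pos] by simp
    qed
    then show "\<beta> powi p i \<le> d (x i) (x j)" "d (x i) (x j) \<le> \<beta> * \<beta> powi p i" by blast+
    show "p j \<le> p i" "p i mod int r = p j mod int r" using I(3) ij by blast+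
  qed
qed

section \<open>Lower bounds valid for every \<open>\<alpha> > 1\<close>\<close>

lemma D_1_ge:
  assumes "\<alpha> > 1" "2 \<le> \<alpha> ^ K" "0 < s" "(2 * (K + 1)) ^ ((K + 1) * s) \<le> n"
  shows "s \<le> D 1 \<alpha> n"
proof (rule D_ge)
  fix M :: "nat set" and d assume M: "Metric_space M d" "finite M" "card M = n"
  interpret Metric_space M d by fact
  have card: "(2 * (K + 1)) ^ ((K + 1) * 1 * s) \<le> card M" using assms(4) M(3) by simp
  obtain x :: "nat \<Rightarrow> nat" and I :: "nat set" and p where I:
    "finite I" "inj_on x I" "x ` I \<subseteq> M" "s \<le> card I"
    and dist: "\<forall>i\<in>I. \<forall>j\<in>I. i < j \<longrightarrow>
      \<alpha> powi p i \<le> d (x i) (x j) \<and> d (x i) (x j) \<le> \<alpha> * \<alpha> powi p i"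
    and p: "\<forall>i\<in>I. \<forall>j\<in>I. i < j \<longrightarrow> p j \<le> p i \<and> p i mod int 1 = p j mod int 1"
    using aligned_selection[OF order_refl M(2) card assms(1,2) zero_less_one assms(3)] by metis
  have "embeds_lacunary_or_equilateral 1 \<alpha> (x ` I) d"
  proof (rule embeds_lacunaryI[where b = "\<lambda>i. \<alpha> powi p i"])
    \<comment> \<open>For \<open>k = 1\<close> nonincreasing levels are already lacunary, so the
      selection was made with \<open>r = 1\<close>.\<close>
    show "\<alpha> powi p j \<le> \<alpha> powi p i / 1" if "i \<in> I" "j \<in> I" "i < j" for i j
      using p that assms(1) by (auto intro!: power_int_increasing)
  qed (use I dist assms(1) commute in auto)
  then show "\<exists>S\<subseteq>M. s \<le> card S \<and> embeds_lacunary_or_equilateral 1 \<alpha> S d"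
    using I by (intro exI[of _ "x ` I"]) (simp add: card_image)
qed

text \<open>Among \<open>s * s\<close> points with nonincreasing levels, either some level occurs \<open>s\<close> times, which
  gives an equilateral set, or there are \<open>s\<close> distinct levels, which give a lacunary one.\<close>

lemma D_ge_of_square:
  assumes "\<alpha> > 1" "2 \<le> \<alpha> ^ K" "k \<ge> 1" "k \<le> \<alpha> ^ r" "0 < r" "0 < s"
    and "(2 * (K + 1)) ^ ((K + 1) * r * (s * s)) \<le> n"
  shows "s \<le> D k \<alpha> n"
proof (rule D_ge)
  fix M :: "nat set" and d assume M: "Metric_space M d" "finite M" "card M = n"
  interpret Metric_space M d by fact
  have card: "(2 * (K + 1)) ^ ((K + 1) * r * (s * s)) \<le> card M" using assms(7) M(3) by simp
  have ss: "0 < s * s" using assms(6) by simp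
  obtain x :: "nat \<Rightarrow> nat" and I :: "nat set" and p where I:
    "finite I" "inj_on x I" "x ` I \<subseteq> M" "s * s \<le> card I"
    and dist: "\<forall>i\<in>I. \<forall>j\<in>I. i < j \<longrightarrow>
      \<alpha> powi p i \<le> d (x i) (x j) \<and> d (x i) (x j) \<le> \<alpha> * \<alpha> powi p i"
    and p: "\<forall>i\<in>I. \<forall>j\<in>I. i < j \<longrightarrow> p j \<le> p i \<and> p i mod int r = p j mod int r"
    using aligned_selection[OF order_refl M(2) card assms(1,2,5) ss] by metis
  have "I \<noteq> {}" using I(4) ss by auto
  \<comment> \<open>The number of levels times the size of this level class is at least
    \<open>s * s\<close>, so one of the two factors is at least \<open>s\<close>.\<close>
  obtain v where v: "card I \<le> card (p ` I) * card {i \<in> I. p i = v}"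
    using pigeonhole_fibre[OF I(1) \<open>I \<noteq> {}\<close> order_refl, of p] I(1) by auto
  show "\<exists>S\<subseteq>M. s \<le> card S \<and> embeds_lacunary_or_equilateral k \<alpha> S d"
  proof (cases "s \<le> card {i \<in> I. p i = v}")
    case True
    let ?J = "{i \<in> I. p i = v}"
    have inj: "inj_on x ?J" using I(2) by (rule inj_on_subset) auto
    have "embeds_lacunary_or_equilateral k \<alpha> (x ` ?J) d"
    proof (rule embeds_equilateralI[where b = "\<alpha> powi v"])
      fix y z assume "y \<in> x ` ?J" "z \<in> x ` ?J" "y \<noteq> z"
      then obtain i j where ij: "i \<in> ?J" "j \<in> ?J" "y = x i" "z = x j" "i \<noteq> j" by blast
      then consider "i < j" | "j < i" by linarith
      then show "\<alpha> powi v \<le> d y z \<and> d y z \<le> \<alpha> * \<alpha> powi v"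
      proof cases
        case 1
        then show ?thesis using dist ij by auto
      next
        case 2
        then show ?thesis using dist ij commute[of y z] by auto
      qed
    qed (use I(1) assms(1) in auto)
    moreover have "x ` ?J \<subseteq> M" using I(3) by blast
    ultimately show ?thesis using True inj by (intro exI[of _ "x ` ?J"]) (simp add: card_image)
  next
    case False
    have "s \<le> card (p ` I)"
    proof (rule ccontr)
      assume "\<not> ?thesis"
      then have "card (p ` I) * card {i \<in> I. p i = v} < s * s"
        using False by (intro mult_strict_mono) auto
      then show False using v I(4) by simp
    qed
    \<comment> \<open>One index for each level that occurs.\<close>
    let ?J = "inv_into I p ` p ` I"
    have J: "?J \<subseteq> I" by (auto intro: inv_into_into)
    have inj_p: "inj_on p ?J" by (auto simp: inj_on_def f_inv_into_f)
    have card_J: "card ?J = card (p ` I)" by (intro card_image inj_on_inv_into) simp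
    have inj: "inj_on x ?J" using I(2) J by (rule inj_on_subset)
    have "embeds_lacunary_or_equilateral k \<alpha> (x ` ?J) d"
    proof (rule embeds_lacunaryI[where b = "\<lambda>i. \<alpha> powi p i"])
      fix i j assume ij: "i \<in> ?J" "j \<in> ?J" "i < j"
      then have I_ij: "i \<in> I" "j \<in> I" using J by blast+
      have "p i \<noteq> p j" using inj_p ij by (metis inj_onD less_irrefl)
      moreover have p_ij: "p j \<le> p i" "p i mod int r = p j mod int r" using p I_ij ij(3) by blast+
      \<comment> \<open>Distinct levels with equal residue are at least \<open>r\<close> apart, and
        \<open>k \<le> \<alpha> ^ r\<close> turns this gap into decay by \<open>k\<close>.\<close>
      moreover have "int r dvd p i - p j" using p_ij(2) by (simp add: mod_eq_dvd_iff)
      ultimately have "int r \<le> p i - p j" by (intro zdvd_imp_le) auto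
      then have "\<alpha> powi p j * \<alpha> ^ r \<le> \<alpha> powi p i"
        using assms(1) by (simp flip: power_int_of_nat power_int_add add: power_int_increasing)
      moreover have "\<alpha> powi p j * k \<le> \<alpha> powi p j * \<alpha> ^ r"
        using assms(1,4) by (intro mult_left_mono) auto
      ultimately show "\<alpha> powi p j \<le> \<alpha> powi p i / k" using assms(3) by (simp add: field_simps)
    next
      fix i j assume "i \<in> ?J" "j \<in> ?J" "i < j"
      then show "\<alpha> powi p i \<le> d (x i) (x j) \<and> d (x i) (x j) \<le> \<alpha> * \<alpha> powi p i"
        using dist subsetD[OF J] by blast
    qed (use I(1) inj assms(1,3) commute in auto)
    moreover have "x ` ?J \<subseteq> M" using I(3) J by blast
    ultimately show ?thesis using \<open>s \<le> card (p ` I)\<close> inj card_J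
      by (intro exI[of _ "x ` ?J"]) (simp add: card_image)
  qed
qed

section \<open>Shrinking the diameter\<close>

context Metric_space
begin

text \<open>The balls of radius \<open>\<rho>\<close> around a maximal separated set cover
  \<open>N\<close>, and there are at most \<open>m\<close> of them. Sending each point to a near
  centre, the largest fibre is the required subset.\<close>

lemma separated_set_or_small_ball:
  assumes "N \<subseteq> M" "finite N" "N \<noteq> {}" "\<rho> > 0"
    and no_sep: "\<forall>S\<subseteq>N. (\<forall>x\<in>S. \<forall>y\<in>S. x \<noteq> y \<longrightarrow> \<rho> \<le> d x y) \<longrightarrow> card S \<le> m"
  shows "\<exists>N'\<subseteq>N. card N \<le> m * card N' \<and> (\<forall>x\<in>N'. \<forall>y\<in>N'. d x y \<le> 2 * \<rho>)"
proof -
  define P where "P S \<longleftrightarrow> S \<subseteq> N \<and> (\<forall>x\<in>S. \<forall>y\<in>S. x \<noteq> y \<longrightarrow> \<rho> \<le> d x y)" for S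
  have "finite {S. P S}"
    by (rule finite_subset[of _ "Pow N"]) (use assms(2) in \<open>auto simp: P_def\<close>)
  moreover have "{} \<in> {S. P S}" by (simp add: P_def)
  ultimately obtain S where S: "P S" "\<And>T. P T \<Longrightarrow> S \<subseteq> T \<Longrightarrow> S = T"
    using finite_has_maximal2[of "{S. P S}" "{}"] by auto
  have near: "\<exists>y\<in>S. d x y < \<rho>" if "x \<in> N" for x
  proof (cases "x \<in> S")
    case True
    have "x \<in> M" using that assms(1) by blast
    then have "d x x < \<rho>" using \<open>\<rho> > 0\<close> by simp
    then show ?thesis using True by blast
  next
    case False
    then have "\<not> P (insert x S)" using S(2) by blast
    then show ?thesis using S(1) that commute unfolding P_def by (metis insert_iff insert_subset not_le)
  qed
  then obtain c where c: "\<forall>x\<in>N. c x \<in> S \<and> d x (c x) < \<rho>" by metis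
  then have c_S: "c ` N \<subseteq> S" by blast
  have fin: "finite S" using S(1) assms(2) finite_subset unfolding P_def by blast
  obtain y where y: "y \<in> S" "card N \<le> card S * card {x \<in> N. c x = y}"
    using pigeonhole_fibre[OF assms(2,3) c_S fin] by blast
  let ?N' = "{x \<in> N. c x = y}"
  show ?thesis
  proof (intro exI[of _ ?N'] conjI ballI)
    have "card S \<le> m" using S(1) no_sep by (auto simp: P_def)
    then show "card N \<le> m * card ?N'" using y(2) by (meson le_trans mult_le_mono1)
    fix x z assume xz: "x \<in> ?N'" "z \<in> ?N'"
    have "y \<in> M" using y(1) S(1) assms(1) unfolding P_def by blast
    then have "d x z \<le> d x y + d z y" using xz assms(1) by (intro triangle') auto
    moreover have "d x y < \<rho>" "d z y < \<rho>" using c xz by auto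
    ultimately show "d x z \<le> 2 * \<rho>" by linarith
  qed auto
qed

text \<open>Separation by \<open>1 / \<alpha>\<close> of the current diameter bound makes a set
  equilateral up to \<open>\<alpha>\<close>, so such a set has at most \<open>m\<close> points. The
  small ball then improves the bound by the factor \<open>2 / \<alpha>\<close>, and each of the
  \<open>r\<close> rounds costs a factor \<open>m\<close>.\<close>

lemma shrink_diameter:
  assumes "N \<subseteq> M" "finite N" "N \<noteq> {}" "\<alpha> > 0" "\<Delta> > 0"
    and no_eq: "\<forall>S\<subseteq>N. embeds_lacunary_or_equilateral k \<alpha> S d \<longrightarrow> card S \<le> m"
    and "\<forall>x\<in>N. \<forall>y\<in>N. d x y \<le> \<Delta>"
  shows "\<exists>N'\<subseteq>N. card N \<le> m ^ r * card N' \<and> (\<forall>x\<in>N'. \<forall>y\<in>N'. d x y \<le> (2 / \<alpha>) ^ r * \<Delta>)"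
proof (induction r)
  case 0
  then show ?case using assms(7) by (intro exI[of _ N]) auto
next
  case (Suc r)
  then obtain N' where N': "N' \<subseteq> N" "card N \<le> m ^ r * card N'"
    "\<forall>x\<in>N'. \<forall>y\<in>N'. d x y \<le> (2 / \<alpha>) ^ r * \<Delta>" by blast
  let ?\<rho> = "(2 / \<alpha>) ^ r * \<Delta> / \<alpha>"
  have fin: "finite N'" using N'(1) assms(2) finite_subset by blast
  have "card N \<noteq> 0" using assms(2,3) by simp
  then have ne: "N' \<noteq> {}" using N'(2) by auto
  have N'M: "N' \<subseteq> M" and rho: "?\<rho> > 0" using N'(1) assms(1,4,5) by auto
  have no_sep: "\<forall>S\<subseteq>N'. (\<forall>x\<in>S. \<forall>y\<in>S. x \<noteq> y \<longrightarrow> ?\<rho> \<le> d x y) \<longrightarrow> card S \<le> m"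
  proof (intro allI impI)
    fix S assume S: "S \<subseteq> N'" "\<forall>x\<in>S. \<forall>y\<in>S. x \<noteq> y \<longrightarrow> ?\<rho> \<le> d x y"
    have "embeds_lacunary_or_equilateral k \<alpha> S d"
    proof (rule embeds_equilateralI[where b = ?\<rho>])
      show "finite S" using S(1) fin finite_subset by blast
      fix x y assume xy: "x \<in> S" "y \<in> S" "x \<noteq> y"
      then have "d x y \<le> (2 / \<alpha>) ^ r * \<Delta>" using N'(3) S(1) by blast
      then show "?\<rho> \<le> d x y \<and> d x y \<le> \<alpha> * ?\<rho>" using S(2) xy assms(4) by simp
    qed (use rho assms(4) in auto)
    then show "card S \<le> m" using no_eq S(1) N'(1) by blast
  qed
  obtain N'' where N'': "N'' \<subseteq> N'" "card N' \<le> m * card N''"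
    "\<forall>x\<in>N''. \<forall>y\<in>N''. d x y \<le> 2 * ?\<rho>"
    using separated_set_or_small_ball[OF N'M fin ne rho no_sep] by blast
  have "card N \<le> m ^ r * (m * card N'')" using N'(2) N''(2) by (meson le_trans mult_le_mono2)
  then have "card N \<le> m ^ Suc r * card N''" by (simp add: mult_ac)
  moreover have "2 * ?\<rho> = (2 / \<alpha>) ^ Suc r * \<Delta>" by simp
  ultimately show ?case using N'' N'(1) by (intro exI[of _ N'']) (metis subset_trans)
qed

text \<open>Each lacunary point is found at distance comparable to the diameter from a subset so small
  that its own diameter is negligible; the shrinking costs a factor \<open>m ^ r\<close> of the points.\<close>

lemma lacunary_sequence:
  assumes "finite M" "\<alpha> \<ge> 2" "k \<ge> 1" "(2 / \<alpha>) ^ r \<le> 1 / (8 * k)" "2 \<le> m" "0 < r"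
    and no_eq: "\<forall>S\<subseteq>M. embeds_lacunary_or_equilateral k \<alpha> S d \<longrightarrow> card S \<le> m"
    and "N \<subseteq> M" "m ^ (r * s) \<le> card N" "\<forall>x\<in>N. \<forall>y\<in>N. d x y \<le> \<Delta>"
  shows "\<exists>x b. x ` {..<s} \<subseteq> N \<and> (\<forall>i<s. 0 < b i \<and> b i \<le> \<Delta>) \<and>
    (\<forall>i j. i < j \<and> j < s \<longrightarrow> b j \<le> b i / k \<and> b i \<le> d (x i) (x j) \<and> d (x i) (x j) \<le> \<alpha> * b i)"
  using assms(8-10)
proof (induction s arbitrary: N \<Delta>)
  case (Suc s)
  have fin: "finite N" using Suc.prems(1) assms(1) finite_subset by blast
  have le_card: "m ^ r * m ^ (r * s) \<le> card N" using Suc.prems(2) by (simp add: power_add)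
  have "2 ^ 1 \<le> (2 :: nat) ^ r" using \<open>0 < r\<close> by (intro power_increasing) auto
  also have "\<dots> \<le> m ^ r" using \<open>2 \<le> m\<close> by (rule power_mono) simp
  also have "\<dots> \<le> m ^ r * m ^ (r * s)" using \<open>2 \<le> m\<close> by simp
  finally have "2 \<le> card N" using le_card by simp
  then have ne: "N \<noteq> {}" by auto
  obtain u v where uv: "u \<in> N" "v \<in> N" "u \<noteq> v" "d u v > 0"
    and le: "\<forall>x\<in>N. \<forall>y\<in>N. d x y \<le> d u v"
    using diameter_pair[OF Suc.prems(1) fin \<open>2 \<le> card N\<close>] by metis
  have no_eq_N: "\<forall>S\<subseteq>N. embeds_lacunary_or_equilateral k \<alpha> S d \<longrightarrow> card S \<le> m"
    using no_eq Suc.prems(1) by blast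
  have "\<alpha> > 0" using assms(2) by simp
  \<comment> \<open>The total shrinking factor; \<open>1 / 8\<close> leaves room for both the
    distance estimates and the decay by \<open>k\<close>.\<close>
  define \<epsilon> where "\<epsilon> = (2 / \<alpha>) ^ r"
  have \<epsilon>: "\<epsilon> > 0" "\<epsilon> * k \<le> 1 / 8" "\<epsilon> \<le> 1 / 8"
  proof -
    show "\<epsilon> > 0" using assms(2) by (simp add: \<epsilon>_def)
    show *: "\<epsilon> * k \<le> 1 / 8" using assms(3,4) by (simp add: \<epsilon>_def field_simps)
    have "\<epsilon> * 1 \<le> \<epsilon> * k" using \<open>\<epsilon> > 0\<close> assms(3) by (intro mult_left_mono) auto
    then show "\<epsilon> \<le> 1 / 8" using * by simp
  qed
  obtain N' where N': "N' \<subseteq> N" "card N \<le> m ^ r * card N'"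
    and small: "\<forall>x\<in>N'. \<forall>y\<in>N'. d x y \<le> \<epsilon> * d u v"
    using shrink_diameter[OF Suc.prems(1) fin ne \<open>\<alpha> > 0\<close> uv(4) no_eq_N le, of r]
    unfolding \<epsilon>_def by blast
  have card_N': "m ^ (r * s) \<le> card N'"
    by (rule le_of_mult_le_mult_trans[OF le_card N'(2)]) (use \<open>2 \<le> m\<close> in simp)
  moreover have "0 < m ^ (r * s)" using \<open>2 \<le> m\<close> by simp
  ultimately have "N' \<noteq> {}" by force
  then obtain z where z: "z \<in> N'" by blast
  have N'M: "N' \<subseteq> M" using N'(1) Suc.prems(1) by blast
  obtain y where y: "y \<in> N" "d u v / 2 \<le> d y z"
  proof -
    have "d u v \<le> d u z + d v z" using uv z N'M Suc.prems(1) by (intro triangle') auto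
    then have "d u v / 2 \<le> d u z \<or> d u v / 2 \<le> d v z" by linarith
    then show ?thesis using that uv by blast
  qed
  \<comment> \<open>By the triangle inequality \<open>b\<close> is a lower bound for the distance
    from \<open>y\<close> to every point of \<open>N'\<close>. The upper bound is
    \<open>b + 2 * (\<epsilon> * d u v) \<le> 2 * b \<le> \<alpha> * b\<close>, which uses
    \<open>\<alpha> \<ge> 2\<close>.\<close>
  define b where "b = d y z - \<epsilon> * d u v"
  have eps_le: "\<epsilon> * d u v \<le> d u v / 8" using \<epsilon>(3) uv(4) by simp
  have b: "3 / 8 * d u v \<le> b" using y(2) eps_le by (simp add: b_def)
  have dist: "b \<le> d y w \<and> d y w \<le> \<alpha> * b" if "w \<in> N'" for w
  proof -
    have M: "y \<in> M" "z \<in> M" "w \<in> M" using y(1) z that N'M Suc.prems(1) by auto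
    have zw: "d z w \<le> \<epsilon> * d u v" using small z that by blast
    have "d y z \<le> d y w + d z w" "d y w \<le> d y z + d z w" using M by (auto intro: triangle triangle')
    then have "b \<le> d y w" "d y w \<le> b + 2 * (\<epsilon> * d u v)" using zw by (auto simp: b_def)
    moreover have "2 * (\<epsilon> * d u v) \<le> b" using b eps_le uv(4) by linarith
    moreover have "2 * b \<le> \<alpha> * b" using b uv(4) assms(2) by (intro mult_right_mono) auto
    ultimately show ?thesis by linarith
  qed
  have "b \<le> d y z" using \<epsilon>(1) uv(4) by (simp add: b_def)
  also have "\<dots> \<le> \<Delta>" using y z N'(1) Suc.prems(3) by blast
  finally have b_le: "b \<le> \<Delta>" .
  \<comment> \<open>All later terms of the sequence are at most \<open>\<epsilon> * d u v\<close>,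
    so this yields the decay from \<open>b\<close> to each of them.\<close>
  have "\<epsilon> * d u v * k \<le> d u v / 8" using mult_right_mono[OF \<epsilon>(2), of "d u v"] by (simp add: mult_ac)
  then have "\<epsilon> * d u v * k \<le> b" using b uv(4) by linarith
  then have b_k: "\<epsilon> * d u v \<le> b / k" using assms(3) by (simp add: pos_le_divide_eq)
  obtain x c where xc: "x ` {..<s} \<subseteq> N'" "\<forall>i<s. 0 < c i \<and> c i \<le> \<epsilon> * d u v"
    "\<forall>i j. i < j \<and> j < s \<longrightarrow> c j \<le> c i / k \<and> c i \<le> d (x i) (x j) \<and> d (x i) (x j) \<le> \<alpha> * c i"
    using Suc.IH[OF N'M card_N' small] by metis
  have x_mem: "x i \<in> N'" if "i < s" for i using xc(1) that by auto
  have "\<epsilon> * d u v \<le> \<Delta>"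
    using eps_le uv(4) Suc.prems(3)[rule_format, OF uv(1,2)] by linarith
  let ?x = "case_nat y x" and ?b = "case_nat b c"
  have "?x ` {..<Suc s} \<subseteq> N" using x_mem y(1) N'(1) by (auto split: nat.splits) blast
  moreover have "0 < ?b i \<and> ?b i \<le> \<Delta>" if "i < Suc s" for i
  proof (cases i)
    case 0
    then show ?thesis using b b_le uv(4) by simp
  next
    case (Suc i')
    then show ?thesis using xc(2)[rule_format, of i'] that \<open>\<epsilon> * d u v \<le> \<Delta>\<close> by simp
  qed
  moreover have "?b j \<le> ?b i / k \<and> ?b i \<le> d (?x i) (?x j) \<and> d (?x i) (?x j) \<le> \<alpha> * ?b i"
    if "i < j" "j < Suc s" for i j
  proof -
    obtain j' where j': "j = Suc j'" "j' < s" using \<open>i < j\<close> \<open>j < Suc s\<close> by (cases j) auto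
    show ?thesis
    proof (cases i)
      case 0
      have "c j' \<le> b / k" using xc(2)[rule_format, OF j'(2)] b_k by linarith
      then show ?thesis using 0 j' dist[OF x_mem[OF j'(2)]] by simp
    next
      case (Suc i')
      then show ?thesis using xc(3)[rule_format, of i' j'] j' that by simp
    qed
  qed
  ultimately show ?case by (intro exI[of _ ?x] exI[of _ ?b]) blast
qed auto

end

text \<open>If no embeddable subset had \<open>m\<close> points or more, the assumption of
  \<open>lacunary_sequence\<close> would hold, and that lemma with \<open>s = m\<close> produces
  such a subset after all.\<close>

lemma D_ge_of_power:
  assumes "\<alpha> \<ge> 2" "k \<ge> 1" "(2 / \<alpha>) ^ r \<le> 1 / (8 * k)" "0 < r" "2 \<le> m" "m ^ (r * m) \<le> n"
  shows "m \<le> D k \<alpha> n"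
proof (rule D_ge)
  fix M :: "nat set" and d assume M: "Metric_space M d" "finite M" "card M = n"
  interpret Metric_space M d by fact
  show "\<exists>S\<subseteq>M. m \<le> card S \<and> embeds_lacunary_or_equilateral k \<alpha> S d"
  proof (rule ccontr)
    assume neg: "\<not> ?thesis"
    then have small: "\<forall>S\<subseteq>M. embeds_lacunary_or_equilateral k \<alpha> S d \<longrightarrow> card S \<le> m"
      by (meson nle_le)
    let ?\<Delta> = "Max ((\<lambda>(x, y). d x y) ` (M \<times> M))"
    have le: "\<forall>x\<in>M. \<forall>y\<in>M. d x y \<le> ?\<Delta>"
    proof (intro ballI Max_ge)
      show "d x y \<in> (\<lambda>(x, y). d x y) ` (M \<times> M)" if "x \<in> M" "y \<in> M" for x y
        using that by (intro image_eqI[of _ _ "(x, y)"]) auto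
    qed (use M(2) in simp)
    have card: "m ^ (r * m) \<le> card M" using assms(6) M(3) by simp
    obtain x b where x: "x ` {..<m} \<subseteq> M" "\<forall>i<m. 0 < b i \<and> b i \<le> ?\<Delta>"
      "\<forall>i j. i < j \<and> j < m \<longrightarrow> b j \<le> b i / k \<and> b i \<le> d (x i) (x j) \<and> d (x i) (x j) \<le> \<alpha> * b i"
      using lacunary_sequence[OF M(2) assms(1,2,3,5,4) small order_refl card le] by metis
    have inj: "inj_on x {..<m}"
    proof (rule linorder_inj_onI)
      show "x i \<noteq> x j" if "i < j" "i \<in> {..<m}" "j \<in> {..<m}" for i j
      proof
        assume "x i = x j"
        moreover have "x j \<in> M" using x(1) that by auto
        ultimately have "d (x i) (x j) = 0" by simp
        moreover have "0 < b i" "b i \<le> d (x i) (x j)" using x(2,3) that by auto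
        ultimately show False by simp
      qed
    qed auto
    have "embeds_lacunary_or_equilateral k \<alpha> (x ` {..<m}) d"
      by (rule embeds_lacunaryI[where b = b]) (use inj x assms(1,2) commute in auto)
    then show False using neg x(1) inj by (metis card_image card_lessThan order_refl)
  qed
qed

section \<open>Hierarchical metrics on sequences\<close>

lemma distortion_leD:
  assumes "distortion S d dX f \<le> ennreal \<alpha>" "\<alpha> \<ge> 0"
    and "x \<in> S" "y \<in> S" "x \<noteq> y" "u \<in> S" "v \<in> S" "u \<noteq> v"
    and "\<And>x y. x \<in> S \<Longrightarrow> y \<in> S \<Longrightarrow> x \<noteq> y \<Longrightarrow> d x y > 0 \<and> dX (f x) (f y) > 0"
  shows "d u v * dX (f x) (f y) \<le> \<alpha> * (d x y * dX (f u) (f v))"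
proof -
  \<comment> \<open>Each supremum is bounded below by one of its ratios, so expansion at one pair
    times contraction at another is at most \<open>\<alpha>\<close>.\<close>
  have "ennreal (dX (f x) (f y) / d x y) * ennreal (d u v / dX (f u) (f v)) \<le> distortion S d dX f"
    unfolding distortion_def using assms(3-8)
    by (intro mult_mono SUP_upper2[where i = "(x, y)"] SUP_upper2[where i = "(u, v)"]) auto
  also have "\<dots> \<le> ennreal \<alpha>" by fact
  finally have "ennreal ((dX (f x) (f y) / d x y) * (d u v / dX (f u) (f v))) \<le> ennreal \<alpha>"
    using assms(9)[of x y] assms(9)[of u v] assms(3-8) by (subst ennreal_mult) auto
  then have "(dX (f x) (f y) / d x y) * (d u v / dX (f u) (f v)) \<le> \<alpha>"
    using assms(2) by (simp add: ennreal_le_iff)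
  then show ?thesis
    using assms(9)[of x y] assms(9)[of u v] assms(3-8) by (simp add: field_simps)
qed

lemma embeds_pos:
  assumes "Metric_space S d" "Metric_space X dX" "f \<in> S \<rightarrow> X" "inj_on f S"
    "x \<in> S" "y \<in> S" "x \<noteq> y"
  shows "d x y > 0 \<and> dX (f x) (f y) > 0"
proof -
  interpret S: Metric_space S d by fact
  interpret X: Metric_space X dX by fact
  have "f x \<in> X" "f y \<in> X" "f x \<noteq> f y"
    using assms by (auto dest: inj_onD)
  then show ?thesis using assms by (auto simp: less_le)
qed

lemma embeds_equilateralD:
  assumes "Metric_space S d" "equilateral_space X dX" "embeds \<alpha> S d X dX" "\<alpha> \<ge> 0"
    and "x \<in> S" "y \<in> S" "x \<noteq> y" "u \<in> S" "v \<in> S" "u \<noteq> v"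
  shows "d u v \<le> \<alpha> * d x y"
proof -
  obtain f where f: "f \<in> S \<rightarrow> X" "inj_on f S" "distortion S d dX f \<le> ennreal \<alpha>"
    using assms(3) unfolding embeds_def by blast
  obtain r where X: "Metric_space X dX" and r: "\<And>x y. x \<in> X \<Longrightarrow> y \<in> X \<Longrightarrow> x \<noteq> y \<Longrightarrow> dX x y = r"
    using assms(2) unfolding equilateral_space_def by auto
  note pos = embeds_pos[OF assms(1) X f(1,2)]
  have "dX (f x) (f y) = r" "dX (f u) (f v) = r"
    using f assms(5-) by (auto intro!: r dest: inj_onD)
  moreover have "r > 0" using pos[of x y] assms(5-) calculation by auto
  ultimately show ?thesis
    using distortion_leD[OF f(3) assms(4-) pos] by simp
qed

text \<open>Replaces the target by the index \<open>e\<close> of the image and the sequence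
  \<open>a\<close>: a target distance is \<open>a\<close> at the smaller index, and \<open>a\<close>
  falls by at least a factor \<open>k\<close> per unit of \<open>e\<close>.\<close>

lemma embeds_lacunaryE:
  assumes "Metric_space S d" "lacunary_metric k m dX" "embeds \<alpha> S d {1..m} dX" "\<alpha> \<ge> 0" "k \<ge> 1"
  obtains e :: "'a \<Rightarrow> nat" and a :: "nat \<Rightarrow> real" where "inj_on e S"
    "\<And>x. x \<in> S \<Longrightarrow> a (e x) > 0"
    "\<And>x y. x \<in> S \<Longrightarrow> y \<in> S \<Longrightarrow> e x \<le> e y \<Longrightarrow> a (e y) * k ^ (e y - e x) \<le> a (e x)"
    "\<And>x y u v. x \<in> S \<Longrightarrow> y \<in> S \<Longrightarrow> u \<in> S \<Longrightarrow> v \<in> S \<Longrightarrow> e x < e y \<Longrightarrow> e u < e v \<Longrightarrow>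
       d u v * a (e x) \<le> \<alpha> * (d x y * a (e u))"
proof -
  obtain f where f: "f \<in> S \<rightarrow> {1..m}" "inj_on f S" "distortion S d dX f \<le> ennreal \<alpha>"
    using assms(3) unfolding embeds_def by blast
  obtain a where X: "Metric_space {1..m} dX" and a: "lacunary_seq k m a"
    "\<And>i j. 1 \<le> i \<Longrightarrow> i < j \<Longrightarrow> j \<le> m \<Longrightarrow> dX i j = a i"
    using assms(2) unfolding lacunary_metric_def by auto
  note pos = embeds_pos[OF assms(1) X f(1,2)]
  have fm: "1 \<le> f x" "f x \<le> m" if "x \<in> S" for x using f(1) that by fastforce+
  have decay: "a (i + n) * k ^ n \<le> a i" if "1 \<le> i" "i + n \<le> m" for i n
    using that
  proof (induction n)
    case (Suc n)
    have "a (i + Suc n) \<le> a (i + n) / k"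
      using a(1) Suc.prems by (simp add: lacunary_seq_def)
    then have "a (i + Suc n) * k \<le> a (i + n)"
      using \<open>k \<ge> 1\<close> by (simp add: field_simps)
    then have "a (i + Suc n) * k * k ^ n \<le> a (i + n) * k ^ n"
      using \<open>k \<ge> 1\<close> by (intro mult_right_mono) auto
    then show ?case using Suc by (simp add: algebra_simps)
  qed simp
  show ?thesis
  proof (rule that[of f a])
    show "a (f x) > 0" if "x \<in> S" for x
      using a(1) fm[OF that] by (simp add: lacunary_seq_def)
    show "a (f y) * k ^ (f y - f x) \<le> a (f x)" if "x \<in> S" "y \<in> S" "f x \<le> f y" for x y
      using decay[of "f x" "f y - f x"] fm that by simp
    show "d u v * a (f x) \<le> \<alpha> * (d x y * a (f u))"
      if "x \<in> S" "y \<in> S" "u \<in> S" "v \<in> S" "f x < f y" "f u < f v" for x y u v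
    proof -
      have "x \<noteq> y" "u \<noteq> v" using that by auto
      moreover have "dX (f x) (f y) = a (f x)" "dX (f u) (f v) = a (f u)"
        using that fm by (auto intro: a(2))
      ultimately show ?thesis
        using distortion_leD[OF f(3) assms(4) _ _ _ _ _ _ pos, of x y u v] that by simp
    qed
  qed (use f in simp)
qed

text \<open>Arbitrary for \<open>x = y\<close>.\<close>

definition fdiff :: "(nat \<Rightarrow> nat) \<Rightarrow> (nat \<Rightarrow> nat) \<Rightarrow> nat" where
  "fdiff x y = (LEAST i. x i \<noteq> y i)"

lemma fdiff_commute: "fdiff x y = fdiff y x"
  by (simp add: fdiff_def eq_commute)

lemma fdiff_neq: "x \<noteq> y \<Longrightarrow> x (fdiff x y) \<noteq> y (fdiff x y)"
  unfolding fdiff_def by (rule LeastI_ex) auto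

lemma less_fdiff: "i < fdiff x y \<Longrightarrow> x i = y i"
  unfolding fdiff_def using not_less_Least by blast

lemma fdiff_le: "x i \<noteq> y i \<Longrightarrow> fdiff x y \<le> i"
  unfolding fdiff_def by (rule Least_le)

text \<open>Weights between 1 and 2 are compatible with the triangle inequality: two distances on
  one level add up to at least twice the unit \<open>1 / B ^ l\<close> of that level, and no
  distance on that or a deeper level exceeds this.\<close>

locale tree_metric =
  fixes B :: real and w :: "nat \<Rightarrow> nat \<Rightarrow> real"
  assumes B_ge: "B \<ge> 2" and w_commute: "w i j = w j i" and w_ge: "1 \<le> w i j" and w_le: "w i j \<le> 2"
begin

definition tdist :: "(nat \<Rightarrow> nat) \<Rightarrow> (nat \<Rightarrow> nat) \<Rightarrow> real" where
  "tdist x y = (if x = y then 0 else w (x (fdiff x y)) (y (fdiff x y)) / B ^ fdiff x y)"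

lemma tdist_ge: "x \<noteq> y \<Longrightarrow> 1 / B ^ fdiff x y \<le> tdist x y"
  and tdist_le: "tdist x y \<le> 2 / B ^ fdiff x y"
  using B_ge w_ge w_le by (auto simp: tdist_def intro!: divide_right_mono)

lemma tdist_commute: "tdist x y = tdist y x"
  by (simp add: tdist_def fdiff_commute w_commute)

lemma tdist_pos: "x \<noteq> y \<Longrightarrow> tdist x y > 0"
  using tdist_ge[of x y] B_ge by (smt (verit) zero_less_divide_1_iff zero_less_power)

lemma tdist_nonneg: "0 \<le> tdist x y"
  using tdist_pos[of x y] by (cases "x = y") (auto simp: tdist_def)

text \<open>A change at a deeper level affects neither the first difference from \<open>x\<close>
  nor the symbols compared there.\<close>

lemma tdist_eq_if_less:
  assumes "x \<noteq> y" "fdiff x y < fdiff y z \<or> y = z"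
  shows "tdist x z = tdist x y"
proof (cases "y = z")
  case False
  then have less: "fdiff x y < fdiff y z" using assms by simp
  let ?i = "fdiff x y"
  have "x ?i \<noteq> z ?i" using fdiff_neq[OF assms(1)] less_fdiff[OF less] by simp
  moreover have "fdiff x z = ?i"
  proof (rule antisym)
    show "fdiff x z \<le> ?i" using calculation by (rule fdiff_le)
    have "x \<noteq> z" using \<open>x ?i \<noteq> z ?i\<close> by auto
    show "?i \<le> fdiff x z"
    proof (rule ccontr)
      assume "\<not> ?thesis"
      then have "fdiff x z < ?i" by simp
      then have "x (fdiff x z) = y (fdiff x z)" "y (fdiff x z) = z (fdiff x z)"
        using less by (auto intro: less_fdiff)
      then show False using fdiff_neq[OF \<open>x \<noteq> z\<close>] by simp
    qed
  qed
  ultimately show ?thesis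
    using less_fdiff[OF less] assms(1) by (auto simp: tdist_def)
qed simp

lemma Metric_space_tdist: "Metric_space N tdist"
proof
  fix x y z
  show "tdist x z \<le> tdist x y + tdist y z"
  proof (cases "x = y \<or> y = z \<or> x = z")
    case True
    then show ?thesis
      using tdist_nonneg[of x y] tdist_nonneg[of y z] by (auto simp: tdist_def split: if_splits)
  next
    case False
    consider "fdiff x y < fdiff y z" | "fdiff y z < fdiff x y" | "fdiff x y = fdiff y z" by linarith
    then show ?thesis
    proof cases
      case 1
      then show ?thesis using tdist_eq_if_less[of x y z] False tdist_nonneg[of y z] by simp
    next
      case 2
      then have "tdist z x = tdist z y"
        using tdist_eq_if_less[of z y x] False by (auto simp: fdiff_commute[of z y] fdiff_commute[of y x])
      then show ?thesis using tdist_nonneg[of x y] by (simp add: tdist_commute)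
    next
      case 3
      have "fdiff x y \<le> fdiff x z"
      proof (rule ccontr)
        assume "\<not> ?thesis"
        then have "x (fdiff x z) = y (fdiff x z)" "y (fdiff x z) = z (fdiff x z)"
          using 3 by (auto intro: less_fdiff)
        then show False using fdiff_neq[of x z] False by simp
      qed
      then have "2 / B ^ fdiff x z \<le> 2 / B ^ fdiff x y"
        using B_ge by (intro divide_left_mono power_increasing) auto
      then show ?thesis
        using tdist_le[of x z] tdist_ge[of x y] tdist_ge[of y z] False 3 by simp
    qed
  qed
  show "tdist x y = 0 \<longleftrightarrow> x = y"
    using tdist_pos[of x y] by (cases "x = y") (simp add: tdist_def, simp)
qed (fact tdist_nonneg tdist_commute)+

text \<open>Moving to a deeper level divides distances by at least \<open>B / 2\<close>, which is
  more than the factor \<open>\<alpha>\<close> can absorb.\<close>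

lemma fdiff_le_if_tdist_le:
  assumes "tdist u v \<le> \<alpha> * tdist x y" "u \<noteq> v" "x \<noteq> y" "\<alpha> > 0" "2 * \<alpha> < B"
  shows "fdiff x y \<le> fdiff u v"
proof (rule ccontr)
  assume "\<not> ?thesis"
  then have "B ^ Suc (fdiff u v) \<le> B ^ fdiff x y"
    using B_ge by (intro power_increasing) auto
  then have "2 * \<alpha> / B ^ fdiff x y \<le> 2 * \<alpha> / B ^ Suc (fdiff u v)"
    using B_ge assms by (intro divide_left_mono) auto
  also have "\<dots> < 1 / B ^ fdiff u v"
    using B_ge assms by (simp add: field_simps)
  also have "\<dots> \<le> tdist u v" using tdist_ge assms by simp
  also have "\<dots> \<le> \<alpha> * (2 / B ^ fdiff x y)"
    using assms tdist_le[of x y] by (smt (verit) mult_left_mono)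
  finally show False by (simp add: mult.commute)
qed

text \<open>All distances agree up to \<open>\<alpha>\<close>, so they share one level
  \<open>l\<close>. Distinct points then have distinct symbols at \<open>l\<close>, and cancelling
  \<open>B ^ l\<close> leaves the condition on weights.\<close>

lemma equilateral_level:
  assumes "equilateral_space X dX" "embeds \<alpha> S tdist X dX" "\<alpha> > 0" "2 * \<alpha> < B"
  shows "\<exists>l. (\<forall>x\<in>S. \<forall>y\<in>S. x \<noteq> y \<longrightarrow> fdiff x y = l) \<and> inj_on (\<lambda>x. x l) S \<and>
    (\<forall>x\<in>S. \<forall>y\<in>S. x \<noteq> y \<longrightarrow> (\<forall>u\<in>S. \<forall>v\<in>S. u \<noteq> v \<longrightarrow> w (u l) (v l) \<le> \<alpha> * w (x l) (y l)))"
proof -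
  note le = embeds_equilateralD[OF Metric_space_tdist assms(1,2) less_imp_le[OF assms(3)]]
  have eq: "fdiff x y = fdiff u v"
    if "x \<in> S" "y \<in> S" "x \<noteq> y" "u \<in> S" "v \<in> S" "u \<noteq> v" for x y u v
    using that le fdiff_le_if_tdist_le[OF _ _ _ assms(3,4)] by (meson antisym)
  have "\<exists>l. \<forall>x\<in>S. \<forall>y\<in>S. x \<noteq> y \<longrightarrow> fdiff x y = l"
  proof (cases "\<exists>u\<in>S. \<exists>v\<in>S. u \<noteq> v")
    case True
    then obtain u v where "u \<in> S" "v \<in> S" "u \<noteq> v" by blast
    then show ?thesis using eq by blast
  qed blast
  then obtain l where "\<forall>x\<in>S. \<forall>y\<in>S. x \<noteq> y \<longrightarrow> fdiff x y = l" ..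
  then have l: "fdiff x y = l" if "x \<in> S" "y \<in> S" "x \<noteq> y" for x y using that by blast
  show ?thesis
  proof (intro exI[of _ l] conjI ballI impI)
    show "inj_on (\<lambda>x. x l) S"
    proof (rule inj_onI, rule ccontr)
      fix x y assume "x \<in> S" "y \<in> S" "x l = y l" "x \<noteq> y"
      then show False using l[of x y] fdiff_neq[of x y] by simp
    qed
    fix x y u v assume xyuv: "x \<in> S" "y \<in> S" "x \<noteq> y" "u \<in> S" "v \<in> S" "u \<noteq> v"
    show "w (u l) (v l) \<le> \<alpha> * w (x l) (y l)"
      using le[OF xyuv] xyuv l B_ge by (simp add: tdist_def field_simps)
  qed (use l in blast)
qed

text \<open>Every point other than the one with the largest \<open>e\<close> is charged to the level
  at which it first differs from that one; the exception accounts for the 1.\<close>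

lemma card_le_levels:
  fixes e :: "(nat \<Rightarrow> nat) \<Rightarrow> nat"
  assumes "finite S" "inj_on e S"
    and h: "\<And>x y. x \<in> S \<Longrightarrow> y \<in> S \<Longrightarrow> x \<noteq> y \<Longrightarrow> fdiff x y < h"
    and R: "\<And>l. card {x \<in> S. \<exists>y\<in>S. e x < e y \<and> fdiff x y = l} \<le> R"
  shows "card S \<le> 1 + h * R"
proof (cases "S = {}")
  case False
  let ?T = "\<lambda>l. {x \<in> S. \<exists>y\<in>S. e x < e y \<and> fdiff x y = l}"
  have "Max (e ` S) \<in> e ` S" using assms(1) False by (intro Max_in) auto
  then obtain z where "z \<in> S" "Max (e ` S) = e z" by blast
  then have z: "z \<in> S" "\<And>y. y \<in> S \<Longrightarrow> e y \<le> e z"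
    using Max_ge[of "e ` S"] assms(1) by auto
  have "S \<subseteq> {z} \<union> (\<Union>l<h. ?T l)"
  proof
    fix x assume x: "x \<in> S"
    show "x \<in> {z} \<union> (\<Union>l<h. ?T l)"
    proof (cases "x = z")
      case False
      then have "e x < e z" using z x assms(2) by (metis inj_onD le_neq_implies_less)
      then show ?thesis using h[OF x z(1) False] x z(1) by blast
    qed simp
  qed
  then have "card S \<le> card ({z} \<union> (\<Union>l<h. ?T l))"
    using assms(1) by (intro card_mono) auto
  also have "\<dots> \<le> card {z} + card (\<Union>l<h. ?T l)" by (rule card_Un_le)
  also have "card (\<Union>l<h. ?T l) \<le> (\<Sum>l<h. card (?T l))" by (rule card_UN_le) simp
  also have "\<dots> \<le> (\<Sum>l<h. R)" by (intro sum_mono R)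
  finally show ?thesis by simp
qed simp

text \<open>Points charged to one level have later partners at distances equal up to a factor 2, so
  their values of \<open>a\<close> agree up to \<open>2 * \<alpha>\<close>. As \<open>a\<close>
  falls by \<open>k\<close> per index and \<open>2 * \<alpha> < k ^ R\<close>, their indices lie in
  a window of length \<open>R\<close>.\<close>

lemma lacunary_card_le:
  assumes "finite S" "lacunary_metric k m dX" "embeds \<alpha> S tdist {1..m} dX"
    and "\<alpha> > 0" "2 * \<alpha> < B" "k > 1" "2 * \<alpha> < k ^ R"
    and h: "\<And>x y. x \<in> S \<Longrightarrow> y \<in> S \<Longrightarrow> x \<noteq> y \<Longrightarrow> fdiff x y < h"
  shows "card S \<le> 1 + h * R"
proof (rule embeds_lacunaryE[OF Metric_space_tdist assms(2,3) less_imp_le[OF assms(4)]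
      less_imp_le[OF assms(6)]])
  fix e :: "(nat \<Rightarrow> nat) \<Rightarrow> nat" and a
  assume e: "inj_on e S"
    and a_pos: "\<And>x. x \<in> S \<Longrightarrow> a (e x) > 0"
    and decay: "\<And>x y. x \<in> S \<Longrightarrow> y \<in> S \<Longrightarrow> e x \<le> e y \<Longrightarrow> a (e y) * k ^ (e y - e x) \<le> a (e x)"
    and le: "\<And>x y u v. x \<in> S \<Longrightarrow> y \<in> S \<Longrightarrow> u \<in> S \<Longrightarrow> v \<in> S \<Longrightarrow> e x < e y \<Longrightarrow> e u < e v \<Longrightarrow>
       tdist u v * a (e x) \<le> \<alpha> * (tdist x y * a (e u))"
  show ?thesis
  proof (rule card_le_levels[OF assms(1) e h])
    fix l
    let ?T = "{x \<in> S. \<exists>y\<in>S. e x < e y \<and> fdiff x y = l}"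
    have near: "e u < e x + R" if T: "x \<in> ?T" "u \<in> ?T" for x u
    proof (cases "e x \<le> e u")
      case True
      obtain y v where yv: "y \<in> S" "e x < e y" "fdiff x y = l" "v \<in> S" "e u < e v" "fdiff u v = l"
        using T by blast
      have S: "x \<in> S" "u \<in> S" using T by auto
      have "1 / B ^ l * a (e x) \<le> tdist u v * a (e x)"
        using tdist_ge[of u v] yv a_pos[OF S(1)] by (intro mult_right_mono) auto
      also have "\<dots> \<le> \<alpha> * (tdist x y * a (e u))" using le S yv by blast
      also have "\<dots> \<le> \<alpha> * (2 / B ^ l * a (e u))"
        using tdist_le[of x y] yv a_pos[OF S(2)] \<open>\<alpha> > 0\<close>
        by (intro mult_left_mono mult_right_mono) auto
      finally have "a (e x) \<le> 2 * \<alpha> * a (e u)"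
        using B_ge by (simp add: field_simps)
      then have "a (e u) * k ^ (e u - e x) \<le> a (e u) * (2 * \<alpha>)"
        using decay[OF S True] by (simp add: mult_ac)
      then have "k ^ (e u - e x) \<le> 2 * \<alpha>" using a_pos[OF S(2)] by simp
      also have "\<dots> < k ^ R" by fact
      finally show ?thesis using \<open>k > 1\<close> by (simp add: power_strict_increasing_iff)
    qed (use \<open>2 * \<alpha> < k ^ R\<close> in simp)
    show "card ?T \<le> R"
    proof (cases "?T = {}")
      case False
      then obtain x0 where "x0 \<in> ?T" by blast
      from exists_least_iff[of "\<lambda>i. i \<in> e ` ?T"] this obtain x where
        "x \<in> ?T" "\<forall>i. i < e x \<longrightarrow> i \<notin> e ` ?T" by blast
      then have x: "x \<in> ?T" "\<And>u. u \<in> ?T \<Longrightarrow> e x \<le> e u"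
        using not_less by blast+
      have "card ?T = card (e ` ?T)"
        using e by (intro card_image[symmetric]) (auto simp: inj_on_def)
      also have "\<dots> \<le> card {e x..<e x + R}"
      proof (intro card_mono image_subsetI)
        show "e u \<in> {e x..<e x + R}" if "u \<in> ?T" for u
          using near[OF x(1) that] x(2)[OF that] by simp
      qed simp
      finally show ?thesis by simp
    next
      case True
      show ?thesis unfolding True by simp
    qed
  qed
qed

text \<open>For \<open>k = 1\<close> there is no decay to exploit. Instead, all distances from a
  point to later points share a level. Two points charged to the same level \<open>l\<close>,
  together with a third later one, would then show three different symbols at \<open>l\<close>, and
  only two exist.\<close>

lemma binary_lacunary_card_le:
  assumes "finite S" "lacunary_metric 1 m dX" "embeds \<alpha> S tdist {1..m} dX"
    and "\<alpha> > 0" "2 * \<alpha> < B"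
    and h: "\<And>x y. x \<in> S \<Longrightarrow> y \<in> S \<Longrightarrow> x \<noteq> y \<Longrightarrow> fdiff x y < h"
    and two: "\<And>x i. x \<in> S \<Longrightarrow> i < h \<Longrightarrow> x i < 2"
  shows "card S \<le> 1 + h"
proof (rule embeds_lacunaryE[OF Metric_space_tdist assms(2,3) less_imp_le[OF assms(4)] order_refl])
  fix e :: "(nat \<Rightarrow> nat) \<Rightarrow> nat" and a
  assume e: "inj_on e S"
    and a_pos: "\<And>x. x \<in> S \<Longrightarrow> a (e x) > 0"
    and decay: "\<And>x y. x \<in> S \<Longrightarrow> y \<in> S \<Longrightarrow> e x \<le> e y \<Longrightarrow> a (e y) * 1 ^ (e y - e x) \<le> a (e x)"
    and le: "\<And>x y u v. x \<in> S \<Longrightarrow> y \<in> S \<Longrightarrow> u \<in> S \<Longrightarrow> v \<in> S \<Longrightarrow> e x < e y \<Longrightarrow> e u < e v \<Longrightarrow>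
       tdist u v * a (e x) \<le> \<alpha> * (tdist x y * a (e u))"
  have eq: "fdiff x y = fdiff x z" if "x \<in> S" "y \<in> S" "z \<in> S" "e x < e y" "e x < e z" for x y z
  proof -
    have "fdiff x y \<le> fdiff x z" if "y \<in> S" "z \<in> S" "e x < e y" "e x < e z" for y z
    proof (rule fdiff_le_if_tdist_le[OF _ _ _ assms(4,5)])
      show "tdist x z \<le> \<alpha> * tdist x y"
        using le[of x y x z] a_pos[of x] \<open>x \<in> S\<close> that by simp
    qed (use that in auto)
    then show ?thesis using that by (meson antisym)
  qed
  have "card S \<le> 1 + h * 1"
  proof (rule card_le_levels[OF assms(1) e h])
    fix l
    let ?T = "{x \<in> S. \<exists>y\<in>S. e x < e y \<and> fdiff x y = l}"
    have neq: "\<not> e x < e u" if T: "x \<in> ?T" "u \<in> ?T" for x u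
    proof
      assume less: "e x < e u"
      obtain y v where yv: "y \<in> S" "e x < e y" "fdiff x y = l" "v \<in> S" "e u < e v" "fdiff u v = l"
        using T by blast
      have S: "x \<in> S" "u \<in> S" using T by auto
      have "fdiff x u = l" "fdiff x v = l"
        using eq[of x y u] eq[of x y v] yv S less by auto
      moreover have "x \<noteq> u" "x \<noteq> v" "u \<noteq> v" using less yv by auto
      ultimately have "x l \<noteq> u l" "x l \<noteq> v l" "u l \<noteq> v l"
        using fdiff_neq yv by metis+
      moreover have "l < h" using h[OF S(1) yv(1)] yv by auto
      ultimately show False using two[OF S(1)] two[OF S(2)] two[OF yv(4)]
        by (metis less_2_cases_iff)
    qed
    have "x = u" if "x \<in> ?T" "u \<in> ?T" for x u
      using neq[OF that] neq[OF that(2,1)] e that by (auto simp: inj_on_def)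
    then have "card ?T \<le> Suc 0"
      by (subst card_le_Suc0_iff_eq) (use assms(1) in auto)
    then show "card ?T \<le> 1" by simp
  qed
  then show ?thesis by simp
qed

end

section \<open>Upper bounds on \<open>D\<close> from spaces of sequences\<close>

lemma fdiff_PiE_less:
  assumes "x \<in> {..<h} \<rightarrow>\<^sub>E A" "y \<in> {..<h} \<rightarrow>\<^sub>E A" "x \<noteq> y"
  shows "fdiff x y < h"
  using fdiff_neq[OF assms(3)] assms(1,2) by (metis PiE_arb lessThan_iff)

lemma D_le:
  assumes "Metric_space M d" "finite M" "n \<le> card M"
    and "\<And>S. S \<subseteq> M \<Longrightarrow> embeds_lacunary_or_equilateral k \<alpha> S d \<Longrightarrow> card S \<le> m"
  shows "D k \<alpha> n \<le> m"
proof -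
  obtain N where N: "N \<subseteq> M" "card N = n" "finite N"
    using obtain_subset_with_card_n[OF assms(3)] by blast
  have "Metric_space N d" using Metric_space.subspace assms(1) N(1) by blast
  from D_universal[OF this N(3,2), of k \<alpha>] show ?thesis
    using assms(4) N(1) by (metis subset_trans)
qed

text \<open>Counting: a fixed \<open>S\<close> is homogeneous for at most
  \<open>2 * 2 ^ (?p - q)\<close> of the \<open>2 ^ ?p\<close> colourings, and the number of sets
  \<open>S\<close> is too small for these to exhaust all colourings. \<open>E\<close> holds the
  pairs of one colour.\<close>

lemma ex_ramsey_colouring:
  "\<exists>E :: nat set set. \<forall>S\<subseteq>{..<2 ^ t}. card S = 2 * t + 3 \<longrightarrow>
    \<not> {e. e \<subseteq> S \<and> card e = 2} \<subseteq> E \<and> {e. e \<subseteq> S \<and> card e = 2} \<inter> E \<noteq> {}"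
proof (rule ccontr)
  assume neg: "\<not> ?thesis"
  define V where "V = {..<(2 :: nat) ^ t}"
  \<comment> \<open>With this size \<open>q = s * (t + 1) = t * s + s\<close>, which exceeds the
    exponent \<open>t * s + 1\<close> of the union bound.\<close>
  define s where "s = 2 * t + 3"
  define Q where "Q S = {e. e \<subseteq> S \<and> card e = 2}" for S :: "nat set"
  define A where "A = {S. S \<subseteq> V \<and> card S = s}"
  define q where "q = s choose 2"
  let ?p = "card (Q V)"
  have fin_V: "finite V" by (simp add: V_def)
  have fin_Q: "finite (Q S)" if "S \<subseteq> V" for S
    by (rule finite_subset[of _ "Pow S"]) (use that fin_V finite_subset in \<open>auto simp: Q_def\<close>)
  have fin_A: "finite A"
    by (rule finite_subset[of _ "Pow V"]) (use fin_V in \<open>auto simp: A_def\<close>)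
  have QV: "Q S \<subseteq> Q V" if "S \<in> A" for S using that by (auto simp: A_def Q_def)
  have card_Q: "card (Q S) = q" if "S \<in> A" for S
    using that finite_subset[OF _ fin_V] n_subsets[of S 2] by (auto simp: A_def Q_def q_def)
  let ?hom = "\<lambda>S. {F \<in> Pow (Q V). Q S \<subseteq> F} \<union> {F \<in> Pow (Q V). Q S \<inter> F = {}}"
  have cover: "Pow (Q V) \<subseteq> (\<Union>S\<in>A. ?hom S)"
  proof
    fix F assume F: "F \<in> Pow (Q V)"
    have "\<exists>S\<in>A. Q S \<subseteq> F \<or> Q S \<inter> F = {}"
      using neg unfolding A_def Q_def V_def s_def by blast
    then show "F \<in> (\<Union>S\<in>A. ?hom S)" using F by blast
  qed
  have card_hom: "card (?hom S) \<le> 2 * 2 ^ (?p - q)" if "S \<in> A" for S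
  proof -
    have fin: "finite (Q V - Q S)" using fin_Q by blast
    have "card (Q V - Q S) = ?p - q"
      using card_Diff_subset[OF finite_subset[OF QV[OF that] fin_Q] QV[OF that]] card_Q[OF that] by simp
    then have card: "card (Pow (Q V - Q S)) = 2 ^ (?p - q)" using card_Pow[OF fin] by simp
    have "card {F \<in> Pow (Q V). Q S \<subseteq> F} \<le> card (Pow (Q V - Q S))"
      \<comment> \<open>A colouring that contains \<open>Q S\<close> is determined by its part
        outside \<open>Q S\<close>.\<close>
      by (rule card_inj_on_le[of "\<lambda>F. F - Q S"]) (use fin in \<open>auto simp: inj_on_def\<close>)
    moreover have "card {F \<in> Pow (Q V). Q S \<inter> F = {}} \<le> card (Pow (Q V - Q S))"
      by (rule card_mono) (use fin in auto)
    ultimately show ?thesis using card_Un_le[of "{F \<in> Pow (Q V). Q S \<subseteq> F}"] card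
      by (smt (verit) add_mono mult_2 order_trans)
  qed
  \<comment> \<open>The covered family is nonempty, so \<open>A\<close> is nonempty and
    \<open>s \<le> 2 ^ t\<close>, as the binomial estimate requires.\<close>
  have "Pow (Q V) \<noteq> {}" by blast
  then obtain S where S: "S \<in> A" using cover by blast
  have s_le: "s \<le> 2 ^ t" using S card_mono[OF fin_V, of S] by (auto simp: A_def V_def)
  have q_le: "q \<le> ?p" using card_mono[OF fin_Q QV[OF S]] card_Q[OF S] by simp
  have "(2 * t + 3) * (2 * t + 2) = 2 * ((2 * t + 3) * (t + 1))" by simp
  then have q: "q = (2 * t + 3) * (t + 1)"
    unfolding q_def s_def choose_two by simp
  have "2 ^ ?p = card (Pow (Q V))" using fin_Q by (simp add: card_Pow)
  also have "\<dots> \<le> card (\<Union>S\<in>A. ?hom S)"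
    by (rule card_mono[OF _ cover]) (use fin_A fin_Q in auto)
  also have "\<dots> \<le> (\<Sum>S\<in>A. card (?hom S))" by (rule card_UN_le[OF fin_A])
  also have "\<dots> \<le> (\<Sum>S\<in>A. 2 * 2 ^ (?p - q))" by (intro sum_mono card_hom)
  also have "\<dots> = card A * (2 * 2 ^ (?p - q))" by simp
  also have "card A = 2 ^ t choose s"
    unfolding A_def using n_subsets[OF fin_V] by (simp add: V_def)
  also have "(2 ^ t choose s) * (2 * 2 ^ (?p - q)) \<le> (2 ^ t) ^ s * (2 * 2 ^ (?p - q))"
    by (intro mult_right_mono binomial_le_pow s_le) simp
  also have "\<dots> = 2 ^ (t * s + 1 + (?p - q))" by (simp add: power_add power_mult)
  also have "\<dots> < 2 ^ ?p"
  proof (rule power_strict_increasing)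
    have "t * s + 1 < q" unfolding q s_def by (simp add: algebra_simps)
    then show "t * s + 1 + (?p - q) < ?p" using q_le by linarith
  qed simp
  finally show False by simp
qed

lemma (in tree_metric) equilateral_card_le:
  assumes "S \<subseteq> {..<h} \<rightarrow>\<^sub>E {..<q}" "equilateral_space X dX" "embeds \<alpha> S tdist X dX"
    and "\<alpha> > 0" "2 * \<alpha> < B"
  shows "card S \<le> max 1 q"
proof (cases "\<exists>x\<in>S. \<exists>y\<in>S. x \<noteq> y")
  case True
  then obtain x y where xy: "x \<in> S" "y \<in> S" "x \<noteq> y" by blast
  from equilateral_level[OF assms(2-5)] obtain l where L:
    "(\<forall>x\<in>S. \<forall>y\<in>S. x \<noteq> y \<longrightarrow> fdiff x y = l) \<and> inj_on (\<lambda>x. x l) S \<and>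
      (\<forall>x\<in>S. \<forall>y\<in>S. x \<noteq> y \<longrightarrow> (\<forall>u\<in>S. \<forall>v\<in>S. u \<noteq> v \<longrightarrow> w (u l) (v l) \<le> \<alpha> * w (x l) (y l)))" ..
  note l = L[THEN conjunct1] L[THEN conjunct2, THEN conjunct1]
  have "x \<in> {..<h} \<rightarrow>\<^sub>E {..<q}" "y \<in> {..<h} \<rightarrow>\<^sub>E {..<q}" using assms(1) xy by auto
  then have "fdiff x y < h" using xy(3) by (rule fdiff_PiE_less)
  then have "l < h" using l(1) xy by simp
  then have "(\<lambda>x. x l) ` S \<subseteq> {..<q}"
    using PiE_mem[OF subsetD[OF assms(1)]] by (intro image_subsetI) simp
  then have "card S \<le> card {..<q}" using card_inj_on_le[OF l(2)] by blast
  then show ?thesis by simp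
next
  case False
  then have "card S \<le> Suc 0"
    by (cases "finite S") (auto simp: card_le_Suc0_iff_eq)
  then show ?thesis by simp
qed

text \<open>Taking \<open>h = q = m\<close> balances the targets: equilateral subsets are bounded by
  the number of symbols, lacunary ones by a multiple of the length, and the space has
  \<open>m ^ m\<close> points.\<close>

lemma D_le_of_power:
  assumes "\<alpha> > 0" "k > 1" "2 * \<alpha> < k ^ R" "1 \<le> m" "n \<le> m ^ m"
  shows "D k \<alpha> n \<le> m * (R + 1)"
proof -
  interpret tree_metric "max 2 (2 * \<alpha> + 1)" "\<lambda>_ _. 1" by unfold_locales auto
  let ?M = "{..<m} \<rightarrow>\<^sub>E {..<m}"
  have fin: "finite ?M" by (simp add: finite_PiE)
  have B: "2 * \<alpha> < max 2 (2 * \<alpha> + 1)" by simp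
  show ?thesis
  proof (rule D_le[OF Metric_space_tdist fin])
    show "n \<le> card ?M" using assms(5) by (simp add: card_PiE)
    fix S assume S: "S \<subseteq> ?M" "embeds_lacunary_or_equilateral k \<alpha> S tdist"
    have fin_S: "finite S" using S(1) fin finite_subset by blast
    have lt: "fdiff x y < m" if "x \<in> S" "y \<in> S" "x \<noteq> y" for x y
      using fdiff_PiE_less that S(1) by blast
    have "card S \<le> 1 + m * R \<or> card S \<le> max 1 m"
      using S(2) unfolding embeds_lacunary_or_equilateral_def
    proof (elim disjE exE conjE)
      fix j dX assume "lacunary_metric k j dX" "embeds \<alpha> S tdist {1..j} dX"
      then have "card S \<le> 1 + m * R"
        by (rule lacunary_card_le[OF fin_S _ _ assms(1) B assms(2,3) lt])
      then show ?thesis ..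
    next
      fix X :: "nat set" and dX assume "equilateral_space X dX" "embeds \<alpha> S tdist X dX"
      then have "card S \<le> max 1 m" by (rule equilateral_card_le[OF S(1) _ _ assms(1) B])
      then show ?thesis ..
    qed
    then show "card S \<le> m * (R + 1)" using \<open>1 \<le> m\<close> by (auto simp: algebra_simps)
  qed
qed

lemma D_1_le:
  assumes "\<alpha> > 0" "1 \<le> h" "n \<le> 2 ^ h"
  shows "D 1 \<alpha> n \<le> 1 + h"
proof -
  interpret tree_metric "max 2 (2 * \<alpha> + 1)" "\<lambda>_ _. 1" by unfold_locales auto
  let ?M = "{..<h} \<rightarrow>\<^sub>E {..<(2 :: nat)}"
  have fin: "finite ?M" by (simp add: finite_PiE)
  have B: "2 * \<alpha> < max 2 (2 * \<alpha> + 1)" by simp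
  show ?thesis
  proof (rule D_le[OF Metric_space_tdist fin])
    show "n \<le> card ?M" using assms(3) by (simp add: card_PiE)
    fix S assume S: "S \<subseteq> ?M" "embeds_lacunary_or_equilateral 1 \<alpha> S tdist"
    have fin_S: "finite S" using S(1) fin finite_subset by blast
    have lt: "fdiff x y < h" if "x \<in> S" "y \<in> S" "x \<noteq> y" for x y
      using fdiff_PiE_less that S(1) by blast
    have two: "x i < 2" if "x \<in> S" "i < h" for x i
      using PiE_mem[OF subsetD[OF S(1)], of x i] that by simp
    show "card S \<le> 1 + h"
      using S(2) unfolding embeds_lacunary_or_equilateral_def
    proof (elim disjE exE conjE)
      fix j dX assume lac: "lacunary_metric 1 j dX" "embeds \<alpha> S tdist {1..j} dX"
      show ?thesis
        by (rule binary_lacunary_card_le[OF fin_S lac assms(1) B]) (use lt two in auto)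
    next
      fix X :: "nat set" and dX assume "equilateral_space X dX" "embeds \<alpha> S tdist X dX"
      then have "card S \<le> max 1 2" by (rule equilateral_card_le[OF S(1) _ _ assms(1) B])
      then show ?thesis using assms(2) by simp
    qed
  qed
qed

text \<open>For \<open>\<alpha> < 2\<close> an equilateral subset cannot mix the weights 1 and 2.
  Its symbols at its level are therefore homogeneous for the colouring, which allows only
  \<open>2 * t + 2\<close> points in spite of \<open>2 ^ t\<close> symbols.\<close>

lemma D_le_of_square:
  assumes "1 < \<alpha>" "\<alpha> < 2" "k > 1" "4 < k ^ R" "1 \<le> t" "n \<le> (2 ^ t) ^ t"
  shows "D k \<alpha> n \<le> t * (R + 5)"
proof -
  obtain E :: "nat set set" where E_all: "\<forall>S\<subseteq>{..<2 ^ t}. card S = 2 * t + 3 \<longrightarrow>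
    \<not> {e. e \<subseteq> S \<and> card e = 2} \<subseteq> E \<and> {e. e \<subseteq> S \<and> card e = 2} \<inter> E \<noteq> {}"
    using ex_ramsey_colouring[of t] by (elim exE)
  note E = E_all[rule_format]
  define w :: "nat \<Rightarrow> nat \<Rightarrow> real" where "w i j = (if {i, j} \<in> E then 2 else 1)" for i j
  \<comment> \<open>The base 5 exceeds \<open>2 * \<alpha>\<close> for every
    \<open>\<alpha> < 2\<close>, so the space does not depend on \<open>\<alpha>\<close>.\<close>
  interpret tree_metric 5 w by unfold_locales (auto simp: w_def insert_commute)
  let ?M = "{..<t} \<rightarrow>\<^sub>E {..<(2 :: nat) ^ t}"
  have fin: "finite ?M" by (simp add: finite_PiE)
  have \<alpha>: "\<alpha> > 0" "2 * \<alpha> < 5" "2 * \<alpha> < k ^ R" using assms(1,2,4) by auto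
  show ?thesis
  proof (rule D_le[OF Metric_space_tdist fin])
    show "n \<le> card ?M" using assms(6) by (simp add: card_PiE)
    fix S assume S: "S \<subseteq> ?M" "embeds_lacunary_or_equilateral k \<alpha> S tdist"
    have fin_S: "finite S" using S(1) fin finite_subset by blast
    have lt: "fdiff x y < t" if "x \<in> S" "y \<in> S" "x \<noteq> y" for x y
      using fdiff_PiE_less that S(1) by blast
    have "card S \<le> 1 + t * R \<or> card S \<le> 2 * t + 2"
      using S(2) unfolding embeds_lacunary_or_equilateral_def
    proof (elim disjE exE conjE)
      fix j dX assume "lacunary_metric k j dX" "embeds \<alpha> S tdist {1..j} dX"
      then have "card S \<le> 1 + t * R"
        by (rule lacunary_card_le[OF fin_S _ _ \<alpha>(1,2) assms(3) \<alpha>(3) lt])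
      then show ?thesis ..
    next
      fix X :: "nat set" and dX assume X: "equilateral_space X dX" "embeds \<alpha> S tdist X dX"
      have "card S \<le> 2 * t + 2"
      proof (rule ccontr)
        assume "\<not> ?thesis"
        then have "2 * t + 3 \<le> card S" by simp
        then obtain T where T: "T \<subseteq> S" "card T = 2 * t + 3" "finite T"
          using obtain_subset_with_card_n by metis
        have "\<not> card T \<le> Suc 0" using T(2) by simp
        \<comment> \<open>A reference pair: it places the level \<open>l\<close> below
          \<open>t\<close> and fixes the colour that all other pairs must share.\<close>
        then have "\<exists>x0\<in>T. \<exists>y0\<in>T. x0 \<noteq> y0" using card_le_Suc0_iff_eq[OF T(3)] by blast
        then obtain x0 y0 where xy0: "x0 \<in> S" "y0 \<in> S" "x0 \<noteq> y0" using T(1) by blast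
        from equilateral_level[OF X \<alpha>(1,2)] obtain l where L:
          "(\<forall>x\<in>S. \<forall>y\<in>S. x \<noteq> y \<longrightarrow> fdiff x y = l) \<and> inj_on (\<lambda>x. x l) S \<and>
            (\<forall>x\<in>S. \<forall>y\<in>S. x \<noteq> y \<longrightarrow> (\<forall>u\<in>S. \<forall>v\<in>S. u \<noteq> v \<longrightarrow> w (u l) (v l) \<le> \<alpha> * w (x l) (y l)))" ..
        note l = L[THEN conjunct1] L[THEN conjunct2, THEN conjunct1] L[THEN conjunct2, THEN conjunct2]
        let ?T = "(\<lambda>x. x l) ` T"
        have "l < t" using lt[OF xy0] l(1) xy0 by simp
        then have sub: "?T \<subseteq> {..<2 ^ t}"
          using PiE_mem[OF subsetD[OF S(1)]] T(1) by (intro image_subsetI) auto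
        have card_T: "card ?T = 2 * t + 3"
          using T(2) card_image[OF inj_on_subset[OF l(2) T(1)]] by simp
        have same: "{x l, y l} \<in> E \<longleftrightarrow> {u l, v l} \<in> E"
          if "x \<in> S" "y \<in> S" "x \<noteq> y" "u \<in> S" "v \<in> S" "u \<noteq> v" for x y u v
        proof -
          have "w (u l) (v l) \<le> \<alpha> * w (x l) (y l)" "w (x l) (y l) \<le> \<alpha> * w (u l) (v l)"
            using l(3) that by simp_all
          then show ?thesis using assms(2) by (auto simp: w_def split: if_splits)
        qed
        have pair: "\<exists>x\<in>S. \<exists>y\<in>S. x \<noteq> y \<and> e = {x l, y l}" if e: "e \<subseteq> ?T" "card e = 2" for e
        proof -
          obtain a b where ab: "e = {a, b}" "a \<noteq> b" using e(2) by (auto simp: card_2_iff)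
          have "a \<in> ?T" "b \<in> ?T" using e(1) ab(1) by simp_all
          then obtain x y where "x \<in> T" "y \<in> T" "a = x l" "b = y l" by (elim imageE)
          then show ?thesis using ab T(1) by (intro bexI[of _ x] bexI[of _ y]) auto
        qed
        have mono: "e \<in> E \<longleftrightarrow> {x0 l, y0 l} \<in> E" if e: "e \<subseteq> ?T" "card e = 2" for e
        proof -
          obtain x y where "x \<in> S" "y \<in> S" "x \<noteq> y" "e = {x l, y l}"
            using pair[OF e] by (elim bexE conjE)
          then show ?thesis using same[OF xy0] by simp
        qed
        show False
        proof (cases "{x0 l, y0 l} \<in> E")
          case True
          then have "{e. e \<subseteq> ?T \<and> card e = 2} \<subseteq> E" using mono by auto
          then show False using E[OF sub card_T] by simp
        next
          case False
          then have "{e. e \<subseteq> ?T \<and> card e = 2} \<inter> E = {}" using mono by auto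
          then show False using E[OF sub card_T] by simp
        qed
      qed
      then show ?thesis ..
    qed
    then show "card S \<le> t * (R + 5)" using \<open>1 \<le> t\<close> by (auto simp: algebra_simps)
  qed
qed

section \<open>Asymptotic bounds\<close>

text \<open>Singletons embed; this covers those \<open>n\<close> for which the selection arguments
  yield nothing.\<close>

lemma D_pos:
  assumes "1 \<le> n" "\<alpha> \<ge> 0"
  shows "1 \<le> D k \<alpha> n"
proof (rule D_ge)
  fix M :: "nat set" and d assume "Metric_space M d" "finite M" "card M = n"
  then obtain x where "x \<in> M" using assms(1) by (metis all_not_in_conv card.empty not_one_le_zero)
  moreover have "embeds_lacunary_or_equilateral k \<alpha> {x} d"
    by (rule embeds_equilateralI[where b = 1]) (use assms(2) in auto)
  ultimately show "\<exists>S\<subseteq>M. 1 \<le> card S \<and> embeds_lacunary_or_equilateral k \<alpha> S d"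
    by (intro exI[of _ "{x}"]) auto
qed

section \<open>From logarithmic estimates to integer parameters\<close>

lemma power_le_of_ln_le:
  fixes a n e :: nat
  assumes "0 < a" "0 < n" "real e * ln (real a) \<le> ln (real n)"
  shows "a ^ e \<le> n"
proof -
  have "ln (real (a ^ e)) \<le> ln (real n)" using assms by (simp add: ln_realpow)
  then have "real (a ^ e) \<le> real n" using assms(1,2) by (subst (asm) ln_le_cancel_iff) auto
  then show ?thesis by (simp only: of_nat_le_iff)
qed

lemma le_power_of_ln_le:
  fixes a n e :: nat
  assumes "0 < a" "0 < n" "ln (real n) \<le> real e * ln (real a)"
  shows "n \<le> a ^ e"
proof -
  have "ln (real n) \<le> ln (real (a ^ e))" using assms by (simp add: ln_realpow)
  then have "real n \<le> real (a ^ e)" using assms(1,2) by (subst (asm) ln_le_cancel_iff) auto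
  then show ?thesis by (simp only: of_nat_le_iff)
qed

text \<open>Given \<open>1 \<le> m\<close>, rounding \<open>y\<close> down costs at most a factor 2,
  and a vanishing floor needs no further estimate.\<close>

lemma half_le_of_floor:
  fixes m :: nat
  assumes "1 \<le> m" "nat \<lfloor>y\<rfloor> \<noteq> 0 \<Longrightarrow> nat \<lfloor>y\<rfloor> \<le> m"
  shows "y / 2 \<le> real m"
proof (cases "y < 1")
  case False
  then have "1 \<le> \<lfloor>y\<rfloor>" by simp
  then have "nat \<lfloor>y\<rfloor> \<le> m" using assms(2) by simp
  then have "real (nat \<lfloor>y\<rfloor>) \<le> real m" by simp
  moreover have "y < real (nat \<lfloor>y\<rfloor>) + 1" using \<open>1 \<le> \<lfloor>y\<rfloor>\<close> by simp
  ultimately show ?thesis using assms(1) by linarith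
qed (use assms(1) in linarith)

lemma D_1_bounds:
  "\<exists>C > 0. \<forall>\<alpha> :: real. \<alpha> > 1 \<longrightarrow> (\<exists>c > 0. \<forall>n \<ge> 2.
     c * ln (real n) \<le> real (D 1 \<alpha> n) \<and> real (D 1 \<alpha> n) \<le> C * ln (real n))"
proof (rule exI[of _ "3 / ln 2"], intro conjI allI impI)
  fix \<alpha> :: real assume \<alpha>: "\<alpha> > 1"
  obtain K where K: "2 \<le> \<alpha> ^ K" using real_arch_pow[OF \<alpha>] less_imp_le by blast
  have "K \<noteq> 0" using K by (intro notI) simp
  \<comment> \<open>Chosen so that \<open>s * c \<le> ln n\<close> is the logarithm of the size
    condition in \<open>D_1_ge\<close>.\<close>
  define c where "c = real (K + 1) * ln (real (2 * (K + 1)))"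
  have c: "c > 0" unfolding c_def by (intro mult_pos_pos ln_gt_zero) auto
  have lower: "1 / (2 * c) * ln (real n) \<le> real (D 1 \<alpha> n)" if n: "2 \<le> n" for n
  proof -
    define s where "s = nat \<lfloor>ln (real n) / c\<rfloor>"
    have pos: "0 \<le> ln (real n) / c" using n c by simp
    have "s \<le> D 1 \<alpha> n" if "s \<noteq> 0"
    proof (rule D_1_ge[OF \<alpha> K])
      have "real s \<le> ln (real n) / c" unfolding s_def using pos by (rule of_nat_floor)
      then have "real s * c \<le> ln (real n)" using c by (simp add: pos_le_divide_eq)
      also have "real s * c = real ((K + 1) * s) * ln (real (2 * (K + 1)))"
        by (simp add: c_def algebra_simps)
      finally show "(2 * (K + 1)) ^ ((K + 1) * s) \<le> n"
        using n by (intro power_le_of_ln_le) simp_all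
    qed (use that in simp)
    then have "ln (real n) / c / 2 \<le> real (D 1 \<alpha> n)"
      unfolding s_def using D_pos[of n \<alpha> 1] n \<alpha> by (intro half_le_of_floor) auto
    then show ?thesis by (simp add: mult.commute)
  qed
  have upper: "real (D 1 \<alpha> n) \<le> 3 / ln 2 * ln (real n)" if n: "2 \<le> n" for n
  proof -
    define y where "y = ln (real n) / ln 2"
    define h where "h = nat \<lceil>y\<rceil>"
    have y: "1 \<le> y" using n by (simp add: y_def)
    have h: "y \<le> real h" "real h \<le> y + 1" using y unfolding h_def by linarith+
    have "1 \<le> h" using h(1) y by linarith
    moreover have "n \<le> 2 ^ h"
      using h(1) n unfolding y_def by (intro le_power_of_ln_le) (auto simp: pos_divide_le_eq)
    ultimately have "D 1 \<alpha> n \<le> 1 + h" using D_1_le[of \<alpha>] \<alpha> by simp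
    then have "real (D 1 \<alpha> n) \<le> 1 + real h" by linarith
    also have "\<dots> \<le> 3 * y" using h(2) y by linarith
    finally show ?thesis by (simp add: y_def)
  qed
  show "\<exists>c>0. \<forall>n\<ge>2. c * ln (real n) \<le> real (D 1 \<alpha> n) \<and> real (D 1 \<alpha> n) \<le> 3 / ln 2 * ln (real n)"
    using lower upper c by (intro exI[of _ "1 / (2 * c)"]) simp
qed simp

lemma D_small_distortion_bounds:
  assumes k: "k > 1"
  shows "\<exists>C > 0. \<forall>\<alpha> :: real. 1 < \<alpha> \<and> \<alpha> < 2 \<longrightarrow> (\<exists>c > 0. \<forall>n \<ge> 2.
     c * sqrt (ln (real n)) \<le> real (D k \<alpha> n) \<and> real (D k \<alpha> n) \<le> C * sqrt (ln (real n)))"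
proof -
  \<comment> \<open>Fixed before \<open>\<alpha>\<close>: since \<open>2 * \<alpha> < 4\<close>
    throughout the range, \<open>C\<close> depends on \<open>k\<close> alone.\<close>
  obtain R where R: "4 < k ^ R" using real_arch_pow[OF k] by blast
  define C where "C = 2 * (real R + 5) / sqrt (ln 2)"
  have "C > 0" by (simp add: C_def)
  moreover have "\<exists>c > 0. \<forall>n \<ge> 2.
     c * sqrt (ln (real n)) \<le> real (D k \<alpha> n) \<and> real (D k \<alpha> n) \<le> C * sqrt (ln (real n))"
    if "1 < \<alpha> \<and> \<alpha> < 2" for \<alpha>
  proof -
    have \<alpha>: "1 < \<alpha>" "\<alpha> < 2" using that by auto
    obtain K where K: "2 \<le> \<alpha> ^ K" using real_arch_pow[OF \<alpha>(1)] less_imp_le by blast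
    have "K \<noteq> 0" using K by (intro notI) simp
    obtain r where "k < \<alpha> ^ r" using real_arch_pow[OF \<alpha>(1)] by blast
    then have r: "k \<le> \<alpha> ^ r" "0 < r" using k by (auto intro: gr0I)
    define c where "c = real ((K + 1) * r) * ln (real (2 * (K + 1)))"
    have c: "c > 0"
      unfolding c_def of_nat_mult[of "K + 1" r] using r(2) \<open>K \<noteq> 0\<close>
      by (intro mult_pos_pos ln_gt_zero) simp_all
    have lower: "1 / (2 * sqrt c) * sqrt (ln (real n)) \<le> real (D k \<alpha> n)" if n: "2 \<le> n" for n
    proof -
      let ?y = "sqrt (ln (real n) / c)"
      define s where "s = nat \<lfloor>?y\<rfloor>"
      have pos: "0 \<le> ln (real n) / c" using n c by simp
      have "s \<le> D k \<alpha> n" if "s \<noteq> 0"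
      proof (rule D_ge_of_square[OF \<alpha>(1) K _ r])
        have "real s \<le> ?y" unfolding s_def using pos by (intro of_nat_floor) simp
        then have "real s * real s \<le> ?y * ?y" by (intro mult_mono) (use pos in auto)
        also have "\<dots> = ln (real n) / c" using pos by (rule real_sqrt_mult_self[THEN trans, OF abs_of_nonneg])
        finally have "real s * real s * c \<le> ln (real n)" using c by (simp add: pos_le_divide_eq)
        also have "real s * real s * c = real ((K + 1) * r * (s * s)) * ln (real (2 * (K + 1)))"
          by (simp add: c_def algebra_simps)
        finally show "(2 * (K + 1)) ^ ((K + 1) * r * (s * s)) \<le> n"
          using n by (intro power_le_of_ln_le) simp_all
      qed (use that k in simp_all)
      then have "?y / 2 \<le> real (D k \<alpha> n)"
        unfolding s_def using D_pos[of n \<alpha> k] n \<alpha> by (intro half_le_of_floor) auto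
      then show ?thesis by (simp add: real_sqrt_divide mult.commute)
    qed
    have upper: "real (D k \<alpha> n) \<le> C * sqrt (ln (real n))" if n: "2 \<le> n" for n
    proof -
      \<comment> \<open>The square root of the binary logarithm of \<open>n\<close>, so that
        \<open>t \<ge> y\<close> gives \<open>n \<le> 2 ^ (t * t)\<close>.\<close>
      define y where "y = sqrt (ln (real n) / ln 2)"
      define t where "t = nat \<lceil>y\<rceil>"
      have y: "1 \<le> y" using n by (simp add: y_def)
      have t: "y \<le> real t" "real t \<le> y + 1" using y unfolding t_def by linarith+
      have "1 \<le> t" using t(1) y by linarith
      moreover have "n \<le> (2 ^ t) ^ t"
      proof -
        have "0 \<le> ln (real n) / ln 2" using n by simp
        then have "ln (real n) / ln 2 = y * y"
          unfolding y_def by (simp only: real_sqrt_mult_self abs_of_nonneg)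
        also have "\<dots> \<le> real t * real t" using t(1) y by (intro mult_mono) auto
        finally have "ln (real n) \<le> real (t * t) * ln (real 2)" by (simp add: pos_divide_le_eq)
        then have "n \<le> 2 ^ (t * t)" using n by (intro le_power_of_ln_le) auto
        then show ?thesis by (simp add: power_mult)
      qed
      ultimately have "D k \<alpha> n \<le> t * (R + 5)" by (rule D_le_of_square[OF \<alpha> k R])
      then have "real (D k \<alpha> n) \<le> real (t * (R + 5))" by (simp only: of_nat_le_iff)
      also have "\<dots> = real t * (real R + 5)" by (simp add: algebra_simps)
      also have "\<dots> \<le> (2 * y) * (real R + 5)" using t(2) y by (intro mult_right_mono) auto
      also have "\<dots> = C * sqrt (ln (real n))" by (simp add: C_def y_def real_sqrt_divide)
      finally show ?thesis .
    qed
    show ?thesis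
      using lower upper c by (intro exI[of _ "1 / (2 * sqrt c)"]) simp
  qed
  ultimately show ?thesis by blast
qed

text \<open>Follows from \<open>ln x \<le> x - 1\<close> at \<open>x = ln L / 2\<close>. It ensures
  \<open>L \<le> m * ln m\<close> for \<open>m\<close> at least
  \<open>2 * (L / ln L)\<close>.\<close>

lemma half_ln_le_ln_of_quotient:
  fixes L :: real
  assumes "L > 1"
  shows "ln L / 2 \<le> ln (2 * (L / ln L))"
proof -
  have z: "0 < ln L" using assms by (rule ln_gt_zero)
  have "ln (ln L / 2) \<le> ln L / 2 - 1" using z by (intro ln_le_minus_one) auto
  then have "ln (ln L) - ln 2 \<le> ln L / 2" using z by (simp add: ln_div)
  moreover have "ln (2 * (L / ln L)) = ln 2 + ln L - ln (ln L)"
    using z assms by (simp add: ln_mult ln_div)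
  ultimately show ?thesis by simp
qed

lemma D_large_distortion_upper:
  assumes "\<alpha> > 0" "k > 1"
  shows "\<exists>C > 0. \<forall>n \<ge> 3. real (D k \<alpha> n) \<le> C * (ln (real n) / ln (ln (real n)))"
proof -
  obtain R where R: "2 * \<alpha> < k ^ R" using real_arch_pow[OF assms(2)] by blast
  have "real (D k \<alpha> n) \<le> 3 * (real R + 1) * (ln (real n) / ln (ln (real n)))" if n: "3 \<le> n" for n
  proof -
    define L where "L = ln (real n)"
    have "ln 3 \<le> L" using n by (simp add: L_def)
    then have L: "1 < L" using ln3_gt_1 by linarith
    then have z: "0 < ln L" by (rule ln_gt_zero)
    define y where "y = L / ln L"
    have "ln L < L" using L by (intro ln_less_self) simp
    then have y: "1 \<le> y" using z by (simp add: y_def)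
    define m where "m = nat \<lceil>2 * y\<rceil>"
    have m: "2 * y \<le> real m" "real m \<le> 2 * y + 1" using y unfolding m_def by linarith+
    have m1: "1 \<le> m" using m(1) y by linarith
    have "ln L / 2 \<le> ln (2 * y)" unfolding y_def by (rule half_ln_le_ln_of_quotient[OF L])
    also have "\<dots> \<le> ln (real m)" using m(1) y by (subst ln_le_cancel_iff) auto
    finally have ln_m: "ln L / 2 \<le> ln (real m)" .
    have "L = 2 * y * (ln L / 2)" using z by (simp add: y_def)
    also have "\<dots> \<le> real m * ln (real m)" using m(1) ln_m z y by (intro mult_mono) auto
    finally have "n \<le> m ^ m" using n m1 by (intro le_power_of_ln_le) (auto simp: L_def)
    then have "D k \<alpha> n \<le> m * (R + 1)" by (rule D_le_of_power[OF assms R m1])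
    then have "real (D k \<alpha> n) \<le> real (m * (R + 1))" by (simp only: of_nat_le_iff)
    also have "\<dots> = real m * (real R + 1)" by (simp add: algebra_simps)
    also have "\<dots> \<le> (3 * y) * (real R + 1)" using m(2) y by (intro mult_right_mono) auto
    also have "\<dots> = 3 * (real R + 1) * y" by (simp add: algebra_simps)
    finally show ?thesis unfolding y_def L_def .
  qed
  then show ?thesis by (intro exI[of _ "3 * (real R + 1)"]) simp
qed

lemma D_large_distortion_lower:
  assumes "\<alpha> > 2" "k > 1"
  shows "\<exists>c > 0. \<forall>n \<ge> 3. c * (ln (real n) / ln (ln (real n))) \<le> real (D k \<alpha> n)"
proof -
  obtain r where "(2 / \<alpha>) ^ r < 1 / (8 * k)"
    using real_arch_pow_inv[of "1 / (8 * k)" "2 / \<alpha>"] assms by auto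
  then have r: "(2 / \<alpha>) ^ r \<le> 1 / (8 * k)" "0 < r"
    using assms by (auto intro!: gr0I simp: divide_simps)
  have lnln3: "0 < ln (ln (3 :: real))" using ln3_gt_1 by simp
  \<comment> \<open>The first term is the rate obtained for \<open>L \<ge> exp 1\<close>; the second
    makes the trivial bound \<open>1 \<le> D k \<alpha> n\<close> sufficient for
    \<open>L < exp 1\<close>.\<close>
  define c where "c = min (1 / (2 * real r)) (ln (ln 3) / exp 1)"
  have c: "c > 0" using lnln3 r(2) by (simp add: c_def)
  have "c * (ln (real n) / ln (ln (real n))) \<le> real (D k \<alpha> n)" if n: "3 \<le> n" for n
  proof -
    define L where "L = ln (real n)"
    have L3: "ln 3 \<le> L" using n by (simp add: L_def)
    then have L: "1 < L" using ln3_gt_1 by linarith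
    have z: "0 < ln L" using L by (rule ln_gt_zero)
    have D1: "1 \<le> D k \<alpha> n" using D_pos[of n \<alpha> k] n assms by simp
    let ?y = "L / ln L"
    have y: "0 < ?y" using L z by simp
    show ?thesis
    proof (cases "L < exp 1")
      case True
      have "ln (ln 3) \<le> ln L" using L3 ln3_gt_1 L by (subst ln_le_cancel_iff) auto
      then have "?y \<le> exp 1 / ln (ln 3)"
        using True L lnln3 by (intro frac_le) auto
      then have "c * ?y \<le> (ln (ln 3) / exp 1) * (exp 1 / ln (ln 3))"
        using y lnln3 by (intro mult_mono) (auto simp: c_def)
      also have "\<dots> = 1" using lnln3 by simp
      finally show ?thesis using D1 by (simp add: L_def)
    next
      case False
      \<comment> \<open>This gives \<open>m \<le> L\<close>, so \<open>ln m \<le> ln L\<close> and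
        \<open>r * m * ln m \<le> L\<close>, the logarithmic form of
        \<open>m ^ (r * m) \<le> n\<close>.\<close>
      then have ln_L: "1 \<le> ln L" using L by (subst ln_ge_iff) auto
      define m where "m = nat \<lfloor>?y / real r\<rfloor>"
      have m: "real m \<le> ?y / real r" unfolding m_def using y by (intro of_nat_floor divide_nonneg_nonneg[OF less_imp_le]) simp_all
      have "m \<le> D k \<alpha> n" if "m \<noteq> 0"
      proof (cases "m = 1")
        case False
        have "?y / real r \<le> L / (1 * 1)"
          using ln_L r(2) L unfolding divide_divide_eq_left by (intro divide_left_mono mult_mono) auto
        then have "real m \<le> L" using m by simp
        then have "ln (real m) \<le> ln L" using that L by (subst ln_le_cancel_iff) auto
        then have "real m * ln (real m) \<le> (?y / real r) * ln L"
          using m y z that by (intro mult_mono) auto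
        also have "\<dots> = L / real r" using z by simp
        finally have "real (r * m) * ln (real m) \<le> L"
          using r(2) by (simp add: field_simps)
        then have "m ^ (r * m) \<le> n"
          using n that by (intro power_le_of_ln_le) (auto simp: L_def)
        then show ?thesis using D_ge_of_power[OF _ _ r, of m n] assms that False by simp
      qed (use D1 in simp)
      then have "?y / real r / 2 \<le> real (D k \<alpha> n)"
        unfolding m_def using D1 by (intro half_le_of_floor)
      moreover have "c * ?y \<le> 1 / (2 * real r) * ?y"
        using y by (intro mult_right_mono) (auto simp: c_def)
      ultimately show ?thesis by (simp add: L_def mult_ac)
    qed
  qed
  then show ?thesis using c by blast
qed

text \<open>The threshold \<open>n \<ge> 3\<close> makes \<open>ln (ln n)\<close> positive;
  \<open>n \<ge> 2\<close> excludes \<open>n = 1\<close>, where \<open>ln n\<close> vanishes but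
  \<open>D\<close> is 1. The order of the quantifiers expresses on which parameters each constant
  may depend.\<close>

theorem theorem1p9:
  shows
    "(\<forall>\<alpha> k :: real. \<alpha> > 2 \<and> k > 1 \<longrightarrow>
        (\<exists>c > 0. \<exists>C > 0. \<forall>n \<ge> 3.
           c * (ln (real n) / ln (ln (real n))) \<le> real (D k \<alpha> n) \<and>
           real (D k \<alpha> n) \<le> C * (ln (real n) / ln (ln (real n))))) \<and>
     (\<forall>k :: real. k > 1 \<longrightarrow>
        (\<exists>C > 0. \<forall>\<alpha> :: real. 1 < \<alpha> \<and> \<alpha> < 2 \<longrightarrow>
          (\<exists>c > 0. \<forall>n \<ge> 2.
             c * sqrt (ln (real n)) \<le> real (D k \<alpha> n) \<and>
             real (D k \<alpha> n) \<le> C * sqrt (ln (real n))))) \<and>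
     (\<exists>C > 0. \<forall>\<alpha> :: real. \<alpha> > 1 \<longrightarrow>
        (\<exists>c > 0. \<forall>n \<ge> 2.
           c * ln (real n) \<le> real (D 1 \<alpha> n) \<and>
           real (D 1 \<alpha> n) \<le> C * ln (real n)))"
proof (intro conjI allI impI)
  fix \<alpha> k :: real assume "\<alpha> > 2 \<and> k > 1"
  then have \<alpha>: "\<alpha> > 2" "\<alpha> > 0" and k: "k > 1" by auto
  show "\<exists>c > 0. \<exists>C > 0. \<forall>n \<ge> 3.
      c * (ln (real n) / ln (ln (real n))) \<le> real (D k \<alpha> n) \<and>
      real (D k \<alpha> n) \<le> C * (ln (real n) / ln (ln (real n)))"
    using D_large_distortion_lower[OF \<alpha>(1) k] D_large_distortion_upper[OF \<alpha>(2) k] by metis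
next
  show "\<exists>C > 0. \<forall>\<alpha> :: real. 1 < \<alpha> \<and> \<alpha> < 2 \<longrightarrow> (\<exists>c > 0. \<forall>n \<ge> 2.
      c * sqrt (ln (real n)) \<le> real (D k \<alpha> n) \<and> real (D k \<alpha> n) \<le> C * sqrt (ln (real n)))"
    if "k > 1" for k :: real
    by (rule D_small_distortion_bounds[OF that])
qed (rule D_1_bounds)

end
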